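(* The categories $\mathsf{ChFor}$ and $\mathsf{hFor}$ are isomorphic. In particular, there exists a dual categorical equivalence between $\mathsf{hFor}$ and the category $\mathsf{fPHil_0}$ of finite bounded prelinear Hilbert algebras and homomorphisms.
   Context: A Hilbert algebra is an algebra $(H,\to,1)$ of type $(2,0)$ such that for all $a,b,c\in H$: $a\to(b\to a)=1$; $(a\to(b\to c))\to((a\to b)\to(a\to c))=1$; and $a\to b=b\to a=1$ implies $a=b$. Its natural order is $a\le b$ iff $a\to b=1$. A Hilbert chain is a Hilbert algebra whose natural order is total; a prelinear Hilbert algebra is a member of the variety generated by the Hilbert chains. A bounded prelinear Hilbert algebra is $(H,\to,1,0)$ with $(H,\to,1)$ a prelinear Hilbert algebra and $0\le a$ for all $a$; homomorphisms preserve $\to,1,0$. A finite forest is a finite poset $F$ such that $(x]=\{y:y\le x\}$ is a chain for every $x\in F$. For a subset $U$ of a poset, $U^m$ is the set of minimal elements of $U$ and $[U)$ the upset generated by $U$; $[x)=[\{x\})$. An $h$-base for a finite forest $F$ is a family $\mathcal{B}$ of upsets of $F$ such that (1) $[x)\in\mathcal{B}$ for every $x\in F$; (2) if $B\in\mathcal{B}$ and $M\subseteq B^m$ then $[M)\in\mathcal{B}$. The objects of both $\mathsf{ChFor}$ and $\mathsf{hFor}$ are triples $(X,\le,\mathcal{B}_X)$ with $(X,\le)$ a finite forest and $\mathcal{B}_X$ an $h$-base for it with $X\in\mathcal{B}_X$. Morphisms $(X,\le,\mathcal{B}_X)\to(Y,\le,\mathcal{B}_Y)$ in $\mathsf{ChFor}$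 are relations $R\subseteq X\times Y$ such that, with $R(x)=\{y:(x,y)\in R\}$ and $R^{-1}(U)=\{x:R(x)\cap U\ne\emptyset\}$: $R(x)$ is a nonempty downset for every $x\in X$; if $(x,y)\in R$ then there is $z\in X$ with $z\le x$ and $R(z)=(y]$; and $R^{-1}(U)\in\mathcal{B}_X$ for every $U\in\mathcal{B}_Y$. Composition is composition of relations and the identity is $\ge$. Morphisms in $\mathsf{hFor}$ are order-preserving maps $f:X\to Y$ that are open (if $y\le f(x)$ there is $z\le x$ with $f(z)=y$) and satisfy $f^{-1}(U)\in\mathcal{B}_X$ for every $U\in\mathcal{B}_Y$. *)

theory Defs
  imports
    Complex_Main
    "HOL-Library.FuncSet"
    "HOL-Library.Infinite_Typeclass"
begin

section \<open>Categories\<close>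

text \<open>
  Hom-sets need not be pairwise disjoint, so composition is indexed by the three objects
  involved: \<open>Comp C A B D g f\<close> is the composite of \<open>f : A \<rightarrow> B\<close> followed by \<open>g : B \<rightarrow> D\<close>.
\<close>

record ('o, 'm) category_data =
  Obj :: "'o set"
  Hom :: "'o \<Rightarrow> 'o \<Rightarrow> 'm set"
  Ident :: "'o \<Rightarrow> 'm"
  Comp :: "'o \<Rightarrow> 'o \<Rightarrow> 'o \<Rightarrow> 'm \<Rightarrow> 'm \<Rightarrow> 'm"

locale category =
  fixes C :: "('o, 'm) category_data"
  assumes Ident_in_Hom: "A \<in> Obj C \<Longrightarrow> Ident C A \<in> Hom C A A"
    and Comp_in_Hom:
      "\<lbrakk>A \<in> Obj C; B \<in> Obj C; D \<in> Obj C; f \<in> Hom C A B; g \<in> Hom C B D\<rbrakk>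
        \<Longrightarrow> Comp C A B D g f \<in> Hom C A D"
    and Comp_Ident_right:
      "\<lbrakk>A \<in> Obj C; B \<in> Obj C; f \<in> Hom C A B\<rbrakk> \<Longrightarrow> Comp C A A B f (Ident C A) = f"
    and Comp_Ident_left:
      "\<lbrakk>A \<in> Obj C; B \<in> Obj C; f \<in> Hom C A B\<rbrakk> \<Longrightarrow> Comp C A B B (Ident C B) f = f"
    and Comp_assoc:
      "\<lbrakk>A \<in> Obj C; B \<in> Obj C; D \<in> Obj C; E \<in> Obj C;
        f \<in> Hom C A B; g \<in> Hom C B D; h \<in> Hom C D E\<rbrakk>
        \<Longrightarrow> Comp C A D E h (Comp C A B D g f) = Comp C A B E (Comp C B D E h g) f"

definition op_category :: "('o, 'm) category_data \<Rightarrow> ('o, 'm) category_data" where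
  "op_category C =
    \<lparr>Obj = Obj C,
     Hom = (\<lambda>A B. Hom C B A),
     Ident = Ident C,
     Comp = (\<lambda>A B D g f. Comp C D B A f g)\<rparr>"

definition iso_in :: "('o, 'm) category_data \<Rightarrow> 'o \<Rightarrow> 'o \<Rightarrow> 'm \<Rightarrow> bool" where
  "iso_in C A B f \<longleftrightarrow>
    f \<in> Hom C A B \<and>
    (\<exists>g \<in> Hom C B A. Comp C A B A g f = Ident C A \<and> Comp C B A B f g = Ident C B)"

record ('o1, 'm1, 'o2, 'm2) functor_data =
  fobj :: "'o1 \<Rightarrow> 'o2"
  fmor :: "'o1 \<Rightarrow> 'o1 \<Rightarrow> 'm1 \<Rightarrow> 'm2"

locale cat_functor = C: category C + D: category D
  for C :: "('o1, 'm1) category_data"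
    and D :: "('o2, 'm2) category_data"
    and F :: "('o1, 'm1, 'o2, 'm2) functor_data" +
  assumes fobj_in_Obj: "A \<in> Obj C \<Longrightarrow> fobj F A \<in> Obj D"
    and fmor_in_Hom:
      "\<lbrakk>A \<in> Obj C; B \<in> Obj C; f \<in> Hom C A B\<rbrakk>
        \<Longrightarrow> fmor F A B f \<in> Hom D (fobj F A) (fobj F B)"
    and fmor_Ident: "A \<in> Obj C \<Longrightarrow> fmor F A A (Ident C A) = Ident D (fobj F A)"
    and fmor_Comp:
      "\<lbrakk>A \<in> Obj C; B \<in> Obj C; E \<in> Obj C; f \<in> Hom C A B; g \<in> Hom C B E\<rbrakk>
        \<Longrightarrow> fmor F A E (Comp C A B E g f)
          = Comp D (fobj F A) (fobj F B) (fobj F E) (fmor F B E g) (fmor F A B f)"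

definition id_functor :: "('o, 'm, 'o, 'm) functor_data" where
  "id_functor = \<lparr>fobj = (\<lambda>A. A), fmor = (\<lambda>A B f. f)\<rparr>"

definition comp_functor ::
  "('o2, 'm2, 'o3, 'm3) functor_data \<Rightarrow> ('o1, 'm1, 'o2, 'm2) functor_data
    \<Rightarrow> ('o1, 'm1, 'o3, 'm3) functor_data" where
  "comp_functor G F =
    \<lparr>fobj = (\<lambda>A. fobj G (fobj F A)),
     fmor = (\<lambda>A B f. fmor G (fobj F A) (fobj F B) (fmor F A B f))\<rparr>"

text \<open>Equality of functors with domain \<open>C\<close>, ignoring values outside the objects and hom-sets.\<close>

definition functor_eq_on ::
  "('o1, 'm1) category_data \<Rightarrow> ('o1, 'm1, 'o2, 'm2) functor_data
    \<Rightarrow> ('o1, 'm1, 'o2, 'm2) functor_data \<Rightarrow> bool" where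
  "functor_eq_on C F G \<longleftrightarrow>
    (\<forall>A \<in> Obj C. fobj F A = fobj G A) \<and>
    (\<forall>A \<in> Obj C. \<forall>B \<in> Obj C. \<forall>f \<in> Hom C A B. fmor F A B f = fmor G A B f)"

definition natural_iso ::
  "('o1, 'm1) category_data \<Rightarrow> ('o2, 'm2) category_data
    \<Rightarrow> ('o1, 'm1, 'o2, 'm2) functor_data \<Rightarrow> ('o1, 'm1, 'o2, 'm2) functor_data
    \<Rightarrow> ('o1 \<Rightarrow> 'm2) \<Rightarrow> bool" where
  "natural_iso C D F G \<tau> \<longleftrightarrow>
    cat_functor C D F \<and> cat_functor C D G \<and>
    (\<forall>A \<in> Obj C. iso_in D (fobj F A) (fobj G A) (\<tau> A)) \<and>
    (\<forall>A \<in> Obj C. \<forall>B \<in> Obj C. \<forall>f \<in> Hom C A B.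
      Comp D (fobj F A) (fobj F B) (fobj G B) (\<tau> B) (fmor F A B f)
        = Comp D (fobj F A) (fobj G A) (fobj G B) (fmor G A B f) (\<tau> A))"

definition isomorphic_categories ::
  "('o1, 'm1) category_data \<Rightarrow> ('o2, 'm2) category_data \<Rightarrow> bool" where
  "isomorphic_categories C D \<longleftrightarrow>
    (\<exists>F G. cat_functor C D F \<and> cat_functor D C G \<and>
      functor_eq_on C (comp_functor G F) id_functor \<and>
      functor_eq_on D (comp_functor F G) id_functor)"

definition equivalent_categories ::
  "('o1, 'm1) category_data \<Rightarrow> ('o2, 'm2) category_data \<Rightarrow> bool" where
  "equivalent_categories C D \<longleftrightarrow>
    (\<exists>F G. cat_functor C D F \<and> cat_functor D C G \<and>
      (\<exists>\<eta>. natural_iso C C id_functor (comp_functor G F) \<eta>) \<and>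
      (\<exists>\<epsilon>. natural_iso D D (comp_functor F G) id_functor \<epsilon>))"

definition dually_equivalent_categories ::
  "('o1, 'm1) category_data \<Rightarrow> ('o2, 'm2) category_data \<Rightarrow> bool" where
  "dually_equivalent_categories C D \<longleftrightarrow> equivalent_categories (op_category C) D"


section \<open>Bounded prelinear Hilbert algebras\<close>

record 'a hilbert =
  carrier :: "'a set"
  imp :: "'a \<Rightarrow> 'a \<Rightarrow> 'a"
  one :: 'a

record 'a bhilbert = "'a hilbert" +
  zero :: 'a

text \<open>Algebras of type \<open>(2,0)\<close>.\<close>

locale imp_algebra =
  fixes H :: "('a, 'z) hilbert_scheme"
  assumes one_closed: "one H \<in> carrier H"
    and imp_closed: "\<lbrakk>a \<in> carrier H; b \<in> carrier H\<rbrakk> \<Longrightarrow> imp H a b \<in> carrier H"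

locale hilbert_algebra = imp_algebra H for H :: "('a, 'z) hilbert_scheme" +
  assumes imp_K:
      "\<lbrakk>a \<in> carrier H; b \<in> carrier H\<rbrakk> \<Longrightarrow> imp H a (imp H b a) = one H"
    and imp_S:
      "\<lbrakk>a \<in> carrier H; b \<in> carrier H; c \<in> carrier H\<rbrakk>
        \<Longrightarrow> imp H (imp H a (imp H b c)) (imp H (imp H a b) (imp H a c)) = one H"
    and imp_antisym:
      "\<lbrakk>a \<in> carrier H; b \<in> carrier H; imp H a b = one H; imp H b a = one H\<rbrakk> \<Longrightarrow> a = b"

definition nat_le :: "('a, 'z) hilbert_scheme \<Rightarrow> 'a \<Rightarrow> 'a \<Rightarrow> bool" where
  "nat_le H a b \<longleftrightarrow> imp H a b = one H"

definition hilbert_chain :: "('a, 'z) hilbert_scheme \<Rightarrow> bool" where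
  "hilbert_chain H \<longleftrightarrow>
    hilbert_algebra H \<and> (\<forall>a \<in> carrier H. \<forall>b \<in> carrier H. nat_le H a b \<or> nat_le H b a)"

datatype imp_term = Var nat | One | Imp imp_term imp_term

primrec imp_term_val :: "('a, 'z) hilbert_scheme \<Rightarrow> (nat \<Rightarrow> 'a) \<Rightarrow> imp_term \<Rightarrow> 'a" where
  "imp_term_val H v (Var n) = v n"
| "imp_term_val H v One = one H"
| "imp_term_val H v (Imp s t) = imp H (imp_term_val H v s) (imp_term_val H v t)"

definition models_identities ::
  "('a, 'z) hilbert_scheme \<Rightarrow> (imp_term \<times> imp_term) set \<Rightarrow> bool" where
  "models_identities H E \<longleftrightarrow>
    (\<forall>(s, t) \<in> E. \<forall>v. range v \<subseteq> carrier H \<longrightarrow> imp_term_val H v s = imp_term_val H v t)"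

text \<open>
  A variety is the class of models of a set of identities, and the variety generated by the
  Hilbert chains is the least variety containing them.  The chains range over the same
  universe \<open>'a\<close> as the algebra; as soon as \<open>'a\<close> is infinite, this universe contains a copy of
  every countable chain.  An identity involves only finitely many variables and subalgebras of
  chains are chains, so the resulting variety does not depend on \<open>'a\<close>.
\<close>

definition in_variety_of_chains :: "('a, 'z) hilbert_scheme \<Rightarrow> bool" where
  "in_variety_of_chains H \<longleftrightarrow>
    imp_algebra H \<and>
    (\<forall>E. (\<forall>C :: 'a hilbert. hilbert_chain C \<longrightarrow> models_identities C E) \<longrightarrow> models_identities H E)"

locale prelinear_hilbert_algebra = hilbert_algebra H for H :: "('a, 'z) hilbert_scheme" +
  assumes in_variety: "in_variety_of_chains H"

locale bounded_prelinear_hilbert_algebra =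
  prelinear_hilbert_algebra H for H :: "('a, 'z) bhilbert_scheme" +
  assumes zero_closed: "zero H \<in> carrier H"
    and zero_le: "a \<in> carrier H \<Longrightarrow> nat_le H (zero H) a"

definition bhilbert_hom ::
  "('a, 'y) bhilbert_scheme \<Rightarrow> ('b, 'z) bhilbert_scheme \<Rightarrow> ('a \<Rightarrow> 'b) set" where
  "bhilbert_hom H K =
    {h \<in> carrier H \<rightarrow>\<^sub>E carrier K.
      (\<forall>a \<in> carrier H. \<forall>b \<in> carrier H. h (imp H a b) = imp K (h a) (h b)) \<and>
      h (one H) = one K \<and> h (zero H) = zero K}"

definition fPHil0 :: "('a bhilbert, 'a \<Rightarrow> 'a) category_data" where
  "fPHil0 =
    \<lparr>Obj = {H. bounded_prelinear_hilbert_algebra H \<and> finite (carrier H)},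
     Hom = bhilbert_hom,
     Ident = (\<lambda>H. \<lambda>a \<in> carrier H. a),
     Comp = (\<lambda>H K L. compose (carrier H))\<rparr>"


section \<open>Forests with an h-base\<close>

text \<open>An order is given by the set of pairs \<open>(x, y)\<close> with \<open>x \<le> y\<close>; thus \<open>under r x\<close> is \<open>(x]\<close>.\<close>

definition upset :: "'a set \<Rightarrow> 'a rel \<Rightarrow> 'a set \<Rightarrow> bool" where
  "upset X r U \<longleftrightarrow> U \<subseteq> X \<and> (\<forall>x \<in> U. \<forall>y. (x, y) \<in> r \<longrightarrow> y \<in> U)"

definition downset :: "'a set \<Rightarrow> 'a rel \<Rightarrow> 'a set \<Rightarrow> bool" where
  "downset X r U \<longleftrightarrow> U \<subseteq> X \<and> (\<forall>x \<in> U. \<forall>y. (y, x) \<in> r \<longrightarrow> y \<in> U)"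

definition min_elems :: "'a rel \<Rightarrow> 'a set \<Rightarrow> 'a set" where
  "min_elems r U = {x \<in> U. \<forall>y \<in> U. (y, x) \<in> r \<longrightarrow> y = x}"

definition up_gen :: "'a rel \<Rightarrow> 'a set \<Rightarrow> 'a set" where
  "up_gen r U = {y. \<exists>x \<in> U. (x, y) \<in> r}"

definition finite_forest :: "'a set \<Rightarrow> 'a rel \<Rightarrow> bool" where
  "finite_forest X r \<longleftrightarrow>
    finite X \<and> partial_order_on X r \<and> (\<forall>x \<in> X. under r x \<in> Chains r)"

definition h_base :: "'a set \<Rightarrow> 'a rel \<Rightarrow> 'a set set \<Rightarrow> bool" where
  "h_base X r \<B> \<longleftrightarrow>
    (\<forall>B \<in> \<B>. upset X r B) \<and>
    (\<forall>x \<in> X. up_gen r {x} \<in> \<B>) \<and>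
    (\<forall>B \<in> \<B>. \<forall>M. M \<subseteq> min_elems r B \<longrightarrow> up_gen r M \<in> \<B>)"

record 'a based_forest =
  points :: "'a set"
  order :: "'a rel"
  base :: "'a set set"

definition based_forests :: "'a based_forest set" where
  "based_forests =
    {X. finite_forest (points X) (order X) \<and>
        h_base (points X) (order X) (base X) \<and> points X \<in> base X}"

definition ChFor_hom :: "'a based_forest \<Rightarrow> 'a based_forest \<Rightarrow> 'a rel set" where
  "ChFor_hom X Y =
    {R. R \<subseteq> points X \<times> points Y \<and>
        (\<forall>x \<in> points X. R `` {x} \<noteq> {} \<and> downset (points Y) (order Y) (R `` {x})) \<and>
        (\<forall>(x, y) \<in> R. \<exists>z \<in> points X. (z, x) \<in> order X \<and> R `` {z} = under (order Y) y) \<and>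
        (\<forall>U \<in> base Y. R\<inverse> `` U \<in> base X)}"

definition ChFor :: "('a based_forest, 'a rel) category_data" where
  "ChFor =
    \<lparr>Obj = based_forests,
     Hom = ChFor_hom,
     Ident = (\<lambda>X. (order X)\<inverse>),
     Comp = (\<lambda>X Y Z S R. R O S)\<rparr>"

definition hFor_hom :: "'a based_forest \<Rightarrow> 'a based_forest \<Rightarrow> ('a \<Rightarrow> 'a) set" where
  "hFor_hom X Y =
    {f \<in> points X \<rightarrow>\<^sub>E points Y.
      (\<forall>x \<in> points X. \<forall>y \<in> points X. (x, y) \<in> order X \<longrightarrow> (f x, f y) \<in> order Y) \<and>
      (\<forall>x \<in> points X. \<forall>y \<in> points Y. (y, f x) \<in> order Y
        \<longrightarrow> (\<exists>z \<in> points X. (z, x) \<in> order X \<and> f z = y)) \<and>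
      (\<forall>U \<in> base Y. f -` U \<inter> points X \<in> base X)}"

definition hFor :: "('a based_forest, 'a \<Rightarrow> 'a) category_data" where
  "hFor =
    \<lparr>Obj = based_forests,
     Hom = hFor_hom,
     Ident = (\<lambda>X. \<lambda>x \<in> points X. x),
     Comp = (\<lambda>X Y Z. compose (points X))\<rparr>"

end

theory Submission
  imports Defs
begin

text \<open>
  \<^bold>\<open>The isomorphism.\<close>  A morphism \<open>R : X \<rightarrow> Y\<close> of \<open>ChFor\<close> is monotone, because the inverse image
  of each \<open>[y)\<close> is an upset.  Every \<open>y \<in> R(x)\<close> is the greatest element of \<open>R(z)\<close> for some
  \<open>z \<le> x\<close>, and these \<open>z\<close> form a chain because \<open>X\<close> is a forest.  Hence \<open>R(x)\<close> is a finite
  nonempty chain, so it is \<open>(f x]\<close> for a unique \<open>f x\<close>, and \<open>f\<close> is the corresponding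
  morphism of \<open>hFor\<close> (lemmas \<open>ChFor_hom_image_principal\<close>, \<open>bij_betw_hypograph\<close>).

  \<^bold>\<open>The duality.\<close>  An h-base is closed under \<open>U \<rightarrow> V := [V \<setminus> U)\<close>, and with this implication,
  with \<open>\<emptyset>\<close> as \<open>1\<close> and the whole forest as \<open>0\<close>, it is a Hilbert algebra ordered by reverse
  inclusion.  It is prelinear: for a point \<open>x\<close>, the map \<open>U \<mapsto> [U \<inter> (x])\<close> is a homomorphism onto a
  subalgebra that is a chain since \<open>(x]\<close> is one, and these maps separate the elements
  (lemma \<open>in_variety_of_chains_H\<close>).

  Conversely, call \<open>p \<noteq> 1\<close> irreducible if \<open>a \<rightarrow> p \<in> {p, 1}\<close> for all \<open>a\<close>.  Prelinearity
  makes the irreducibles below a given one comparable, so that the irreducibles form a forest.  In a finite algebra, maximality arguments produce enough irreducibles for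
  \<open>a \<mapsto> {p. a \<le> p}\<close> to be injective and to turn implication into \<open>[V \<setminus> U)\<close>
  (lemmas \<open>irreducible_separation\<close>, \<open>irreducible_above_imp\<close>).  The images of this map form an
  h-base, so every finite bounded prelinear Hilbert algebra comes from a forest.

  On morphisms, an open map \<open>f\<close> gives the homomorphism \<open>U \<mapsto> f\<^sup>-\<^sup>1(U)\<close>.  Every homomorphism \<open>h\<close> has
  this form: for a point \<open>x\<close>, among the \<open>U\<close> with \<open>x \<in> h(U)\<close> there is a least one, and it is \<open>[y)\<close>
  for a point \<open>y\<close>, which is \<open>f x\<close> (lemmas \<open>hom_least_preimage\<close>, \<open>hom_is_pullback\<close>).  So the
  functor is fully faithful and essentially surjective, hence half of a dual equivalence.
\<close>

section \<open>Equivalences and isomorphisms of categories\<close>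

lemma category_op: "category C \<Longrightarrow> category (op_category C)"
  by (unfold_locales) (auto simp: op_category_def category_def)

text \<open>
  A quasi-inverse \<open>G\<close> is obtained by choosing for every object \<open>X\<close> of \<open>D\<close> an object \<open>g X\<close> and
  mutually inverse \<open>i X : F (g X) \<rightarrow> X\<close>, \<open>j X : X \<rightarrow> F (g X)\<close>.  The counit is \<open>i\<close>, the unit is
  the preimage of \<open>j\<close> under \<open>F\<close>, and every required equation between morphisms of \<open>C\<close> is
  checked after applying the faithful functor \<open>F\<close>.
\<close>

lemma fully_faithful_essentially_surjective_imp_equivalent:
  assumes F: "cat_functor C D F"
    and ff: "\<And>A B. A \<in> Obj C \<Longrightarrow> B \<in> Obj C \<Longrightarrow>
      bij_betw (fmor F A B) (Hom C A B) (Hom D (fobj F A) (fobj F B))"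
    and es: "\<And>X. X \<in> Obj D \<Longrightarrow> \<exists>A\<in>Obj C. \<exists>i. iso_in D (fobj F A) X i"
  shows "equivalent_categories C D"
proof -
  interpret cat_functor C D F by (rule F)
  note [simp] = fobj_in_Obj fmor_in_Hom C.Ident_in_Hom D.Ident_in_Hom C.Comp_in_Hom D.Comp_in_Hom
    C.Comp_Ident_left C.Comp_Ident_right D.Comp_Ident_left D.Comp_Ident_right
    fmor_Ident fmor_Comp
  obtain g where g [simp]: "\<And>X. X \<in> Obj D \<Longrightarrow> g X \<in> Obj C"
    and "\<And>X. X \<in> Obj D \<Longrightarrow> \<exists>i. iso_in D (fobj F (g X)) X i"
    using es by metis
  then obtain i j where
    ij [simp]: "\<And>X. X \<in> Obj D \<Longrightarrow> i X \<in> Hom D (fobj F (g X)) X"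
      "\<And>X. X \<in> Obj D \<Longrightarrow> j X \<in> Hom D X (fobj F (g X))"
      "\<And>X. X \<in> Obj D \<Longrightarrow> Comp D (fobj F (g X)) X (fobj F (g X)) (j X) (i X) = Ident D (fobj F (g X))"
      "\<And>X. X \<in> Obj D \<Longrightarrow> Comp D X (fobj F (g X)) X (i X) (j X) = Ident D X"
    unfolding iso_in_def by metis
  have ij_cancel [simp]: "Comp D Z (fobj F (g X)) X (i X) (Comp D Z X (fobj F (g X)) (j X) u) = u"
    if "X \<in> Obj D" "Z \<in> Obj D" "u \<in> Hom D Z X" for X Z u
    using that D.Comp_assoc[of Z X "fobj F (g X)" X u "j X" "i X"] by simp
  define lift where "lift = (\<lambda>A B. inv_into (Hom C A B) (fmor F A B))"
  have lift [simp]: "lift A B u \<in> Hom C A B" "fmor F A B (lift A B u) = u"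
    if "A \<in> Obj C" "B \<in> Obj C" "u \<in> Hom D (fobj F A) (fobj F B)" for A B u
    using ff[OF that(1,2)] that(3) unfolding lift_def bij_betw_def
    by (auto simp: inv_into_into f_inv_into_f)
  have faithful: "u = v" if "A \<in> Obj C" "B \<in> Obj C" "u \<in> Hom C A B" "v \<in> Hom C A B"
    "fmor F A B u = fmor F A B v" for A B u v
    using ff[OF that(1,2)] that unfolding bij_betw_def by (auto dest: inj_onD)
  \<comment> \<open>The quasi-inverse sends \<open>u\<close> to the morphism over the conjugate \<open>j u i\<close>.\<close>
  define cj where "cj = (\<lambda>X Y u. Comp D (fobj F (g X)) X (fobj F (g Y))
    (Comp D X Y (fobj F (g Y)) (j Y) u) (i X))"
  have cj_in [simp]: "cj X Y u \<in> Hom D (fobj F (g X)) (fobj F (g Y))"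
    if "X \<in> Obj D" "Y \<in> Obj D" "u \<in> Hom D X Y" for X Y u
    using that unfolding cj_def by simp
  define G where "G = \<lparr>fobj = g, fmor = (\<lambda>X Y u. lift (g X) (g Y) (cj X Y u))\<rparr>"
  have G: "cat_functor D C G"
  proof
    fix X Y Z u v
    assume *: "X \<in> Obj D" "Y \<in> Obj D" "Z \<in> Obj D" "u \<in> Hom D X Y" "v \<in> Hom D Y Z"
    have "Comp D (fobj F (g X)) (fobj F (g Y)) (fobj F (g Z)) (cj Y Z v) (cj X Y u) =
      cj X Z (Comp D X Y Z v u)"
      using * unfolding cj_def by (simp add: D.Comp_assoc[symmetric])
    then show "fmor G X Z (Comp D X Y Z v u) =
        Comp C (fobj G X) (fobj G Y) (fobj G Z) (fmor G Y Z v) (fmor G X Y u)"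
      using * unfolding G_def by (intro faithful[of "g X" "g Z"]) simp_all
  next
    fix X assume *: "X \<in> Obj D"
    then have "cj X X (Ident D X) = Ident D (fobj F (g X))"
      unfolding cj_def by simp
    then show "fmor G X X (Ident D X) = Ident C (fobj G X)"
      using * unfolding G_def by (intro faithful[of "g X" "g X"]) simp_all
  qed (simp_all add: G_def)
  have idf: "cat_functor K K id_functor" if "category K" for K :: "('x, 'y) category_data"
    using that by (simp add: cat_functor_def cat_functor_axioms_def id_functor_def)
  have compf: "cat_functor K M (comp_functor Q P)" if "cat_functor K L P" "cat_functor L M Q"
    for K :: "('x, 'y) category_data" and L :: "('x1, 'y1) category_data"
      and M :: "('x2, 'y2) category_data" and P Q
    using that by (simp add: cat_functor_def cat_functor_axioms_def comp_functor_def)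
  define \<eta> where "\<eta> = (\<lambda>A. lift A (g (fobj F A)) (j (fobj F A)))"
  have "iso_in C A (g (fobj F A)) (\<eta> A)" if A: "A \<in> Obj C" for A
  proof -
    let ?k = "lift (g (fobj F A)) A (i (fobj F A))"
    have "Comp C A (g (fobj F A)) A ?k (\<eta> A) = Ident C A"
      using A unfolding \<eta>_def by (intro faithful[of A A]) simp_all
    moreover have "Comp C (g (fobj F A)) A (g (fobj F A)) (\<eta> A) ?k = Ident C (g (fobj F A))"
      using A unfolding \<eta>_def by (intro faithful[of "g (fobj F A)" "g (fobj F A)"]) simp_all
    ultimately show ?thesis
      using A unfolding iso_in_def \<eta>_def by (metis fobj_in_Obj g ij(1,2) lift(1))
  qed
  moreover have "Comp C A B (g (fobj F B)) (\<eta> B) f =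
      Comp C A (g (fobj F A)) (g (fobj F B)) (fmor G (fobj F A) (fobj F B) (fmor F A B f)) (\<eta> A)"
    if "A \<in> Obj C" "B \<in> Obj C" "f \<in> Hom C A B" for A B f
    using that unfolding \<eta>_def G_def
    by (intro faithful[of A "g (fobj F B)"]) (simp_all add: cj_def D.Comp_assoc[symmetric])
  ultimately have 1: "natural_iso C C id_functor (comp_functor G F) \<eta>"
    using idf[OF C.category_axioms] compf[OF F G]
    unfolding natural_iso_def by (simp add: comp_functor_def id_functor_def G_def)
  have "iso_in D (fobj F (g X)) X (i X)" if "X \<in> Obj D" for X
    using that ij unfolding iso_in_def by blast
  moreover have "Comp D (fobj F (g X)) (fobj F (g Y)) Y (i Y) (cj X Y u) =
      Comp D (fobj F (g X)) X Y u (i X)"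
    if "X \<in> Obj D" "Y \<in> Obj D" "u \<in> Hom D X Y" for X Y u
    using that unfolding cj_def by (simp add: D.Comp_assoc[symmetric])
  ultimately have 2: "natural_iso D D (comp_functor F G) id_functor i"
    using idf[OF D.category_axioms] compf[OF G F]
    unfolding natural_iso_def by (simp add: comp_functor_def id_functor_def G_def)
  show ?thesis
    unfolding equivalent_categories_def using F G 1 2 by blast
qed

text \<open>
  The category laws of \<open>C\<close> are obtained from those of \<open>D\<close> along the bijections \<open>\<phi>\<close> of hom-sets,
  and the inverse bijections form the functor from \<open>C\<close> to \<open>D\<close>.
\<close>

lemma isomorphic_categories_of_bij_homs:
  assumes D: "category D" and Obj: "Obj C = Obj D"
    and bij: "\<And>A B. A \<in> Obj D \<Longrightarrow> B \<in> Obj D \<Longrightarrow> bij_betw (\<phi> A B) (Hom D A B) (Hom C A B)"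
    and ident: "\<And>A. A \<in> Obj D \<Longrightarrow> \<phi> A A (Ident D A) = Ident C A"
    and comp: "\<And>A B E f g. \<lbrakk>A \<in> Obj D; B \<in> Obj D; E \<in> Obj D; f \<in> Hom D A B; g \<in> Hom D B E\<rbrakk> \<Longrightarrow>
      \<phi> A E (Comp D A B E g f) = Comp C A B E (\<phi> B E g) (\<phi> A B f)"
  shows "isomorphic_categories C D"
proof -
  interpret D: category D by (rule D)
  define \<psi> where "\<psi> = (\<lambda>A B. inv_into (Hom D A B) (\<phi> A B))"
  have \<phi>_in: "\<phi> A B f \<in> Hom C A B" and \<psi>\<phi>: "\<psi> A B (\<phi> A B f) = f"
    if "A \<in> Obj D" "B \<in> Obj D" "f \<in> Hom D A B" for A B f
    using bij[OF that(1,2)] that(3) unfolding \<psi>_def bij_betw_def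
    by (auto simp: inv_into_f_f)
  have \<psi>_in: "\<psi> A B R \<in> Hom D A B" and \<phi>\<psi>: "\<phi> A B (\<psi> A B R) = R"
    if "A \<in> Obj D" "B \<in> Obj D" "R \<in> Hom C A B" for A B R
    using bij[OF that(1,2)] that(3) unfolding \<psi>_def bij_betw_def
    by (auto simp: inv_into_into f_inv_into_f)
  have \<psi>_comp: "Comp C A B E S R = \<phi> A E (Comp D A B E (\<psi> B E S) (\<psi> A B R))"
    if "A \<in> Obj D" "B \<in> Obj D" "E \<in> Obj D" "R \<in> Hom C A B" "S \<in> Hom C B E" for A B E R S
    using comp[OF that(1-3) \<psi>_in[OF that(1,2,4)] \<psi>_in[OF that(2,3,5)]] that
    by (simp add: \<phi>\<psi>)
  note simps = Obj ident[symmetric] \<psi>_comp \<phi>_in \<psi>_in \<phi>\<psi> \<psi>\<phi> D.Ident_in_Hom D.Comp_in_Hom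
    D.Comp_Ident_left D.Comp_Ident_right
  interpret C: category C
    by unfold_locales (simp_all add: simps D.Comp_assoc)
  define F where "F = \<lparr>fobj = (\<lambda>A. A), fmor = \<psi>\<rparr>"
  define G where "G = \<lparr>fobj = (\<lambda>A. A), fmor = \<phi>\<rparr>"
  have "cat_functor C D F"
    by unfold_locales (simp_all add: F_def simps)
  moreover have "cat_functor D C G"
    by unfold_locales (simp_all add: G_def simps)
  ultimately show ?thesis
    unfolding isomorphic_categories_def functor_eq_on_def
    by (intro exI[of _ F] exI[of _ G])
      (simp add: F_def G_def comp_functor_def id_functor_def simps)
qed

section \<open>Forests with an h-base\<close>

text \<open>
  Stated for a bare relation, so that it also applies to the converse of an order, where it yields
  maximal elements.
\<close>

lemma finite_min_below:
  assumes fin: "finite U" and tr: "trans r" and anti: "antisym r" and x: "x \<in> U" and xx: "(x, x) \<in> r"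
  obtains m where "m \<in> min_elems r U" "(m, x) \<in> r"
proof -
  let ?S = "{y \<in> U. (y, x) \<in> r}"
  have "\<exists>m\<in>?S. \<forall>y\<in>?S. y \<noteq> m \<longrightarrow> \<not> ((y, m) \<in> r \<and> y \<noteq> m)"
  proof (rule Finite_Set.bex_min_element)
    show "transp_on ?S (\<lambda>y m. (y, m) \<in> r \<and> y \<noteq> m)"
      using tr anti by (auto intro!: transp_onI dest: transD antisymD)
    show "asymp_on ?S (\<lambda>y m. (y, m) \<in> r \<and> y \<noteq> m)"
      using anti by (auto intro!: asymp_onI dest: antisymD)
  qed (use fin x xx in auto)
  then obtain m where m: "m \<in> U" "(m, x) \<in> r" "\<And>y. \<lbrakk>y \<in> U; (y, x) \<in> r; (y, m) \<in> r\<rbrakk> \<Longrightarrow> y = m"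
    by blast
  then have "m \<in> min_elems r U"
    using tr by (auto simp: min_elems_def dest: transD)
  then show thesis using m(2) that by blast
qed

text \<open>
  For \<open>M \<subseteq> B\<^sup>m\<close> the set \<open>[M)\<close> is reached from \<open>B\<close> by removing the elements \<open>n\<close> of \<open>B\<^sup>m \<setminus> M\<close> one at
  a time: removing \<open>n\<close> replaces the current set \<open>A\<close> by \<open>[A \<setminus> [n))\<close>, because distinct minimal
  elements are incomparable.
\<close>

lemma h_base_if_closed_under_diff:
  assumes po: "partial_order_on X r"
    and ups: "\<And>B. B \<in> \<B> \<Longrightarrow> upset X r B"
    and cone: "\<And>x. x \<in> X \<Longrightarrow> up_gen r {x} \<in> \<B>"
    and diff: "\<And>A B. A \<in> \<B> \<Longrightarrow> B \<in> \<B> \<Longrightarrow> up_gen r (B - A) \<in> \<B>"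
    and fin: "finite X"
  shows "h_base X r \<B>"
proof -
  have refl: "(x, x) \<in> r" if "x \<in> X" for x
    using partial_order_onD(1)[OF po] that by (simp add: refl_on_def)
  have tr: "trans r" and rX: "r \<subseteq> X \<times> X"
    using po partial_order_onD by blast+
  have "up_gen r (min_elems r B - N) \<in> \<B>" if B: "B \<in> \<B>" and "finite N" for B N
    using \<open>finite N\<close>
  proof (induction N)
    case empty
    have up: "y \<in> B" if "x \<in> B" "(x, y) \<in> r" for x y
      using ups[OF B] that unfolding upset_def by auto
    have "up_gen r (min_elems r B) = B"
    proof
      show "up_gen r (min_elems r B) \<subseteq> B"
        using up by (auto simp: up_gen_def min_elems_def)
      show "B \<subseteq> up_gen r (min_elems r B)"
      proof
        fix x assume x: "x \<in> B"
        then have xx: "(x, x) \<in> r" using refl ups[OF B] unfolding upset_def by blast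
        have "finite B" using ups[OF B] fin unfolding upset_def by (auto intro: finite_subset)
        then show "x \<in> up_gen r (min_elems r B)"
          using finite_min_below[OF _ tr partial_order_onD(3)[OF po] x xx]
          unfolding up_gen_def by blast
      qed
    qed
    then show ?case using B by simp
  next
    case (insert n N)
    show ?case
    proof (cases "n \<in> min_elems r B")
      case True
      then have "n \<in> X" using ups[OF B] by (auto simp: min_elems_def upset_def)
      have "up_gen r (min_elems r B - insert n N) =
          up_gen r (up_gen r (min_elems r B - N) - up_gen r {n})" (is "?L = ?R")
      proof
        show "?L \<subseteq> ?R"
        proof
          fix y assume "y \<in> ?L"
          then obtain m where m: "m \<in> min_elems r B" "m \<notin> N" "m \<noteq> n" "(m, y) \<in> r"
            by (auto simp: up_gen_def)
          then have "m \<in> up_gen r (min_elems r B - N)"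
            using rX refl by (auto simp: up_gen_def)
          moreover have "m \<notin> up_gen r {n}"
            using m True by (auto simp: up_gen_def min_elems_def)
          ultimately show "y \<in> ?R"
            using m(4) by (auto simp: up_gen_def)
        qed
        show "?R \<subseteq> ?L"
          using tr unfolding up_gen_def by (auto dest: transD)
      qed
      then show ?thesis using diff[OF cone[OF \<open>n \<in> X\<close>] insert.IH] by simp
    next
      case False
      then have "min_elems r B - insert n N = min_elems r B - N" by blast
      then show ?thesis using insert.IH by simp
    qed
  qed
  moreover have "finite (min_elems r B - M)" "M = min_elems r B - (min_elems r B - M)"
    if "B \<in> \<B>" "M \<subseteq> min_elems r B" for B M
    using that ups[OF that(1)] fin
    by (auto simp: upset_def min_elems_def intro: finite_subset)
  ultimately show ?thesis
    unfolding h_base_def using ups cone by metis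
qed

locale forest =
  fixes X :: "'a based_forest"
  assumes forest: "X \<in> based_forests"
begin

lemma order_refl: "x \<in> points X \<Longrightarrow> (x, x) \<in> order X"
  using forest unfolding based_forests_def finite_forest_def partial_order_on_def
    preorder_on_def refl_on_def by blast

lemma trans_order: "trans (order X)"
  using forest unfolding based_forests_def finite_forest_def partial_order_on_def
    preorder_on_def by blast

lemma order_trans: "(x, y) \<in> order X \<Longrightarrow> (y, z) \<in> order X \<Longrightarrow> (x, z) \<in> order X"
  using trans_order by (rule transD)

lemma antisym_order: "antisym (order X)"
  using forest unfolding based_forests_def finite_forest_def partial_order_on_def by blast

lemma order_antisym: "(x, y) \<in> order X \<Longrightarrow> (y, x) \<in> order X \<Longrightarrow> x = y"
  using antisym_order by (rule antisymD)

lemma order_points: "(x, y) \<in> order X \<Longrightarrow> x \<in> points X \<and> y \<in> points X"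
  using forest unfolding based_forests_def finite_forest_def partial_order_on_def
    preorder_on_def by blast

lemma comparable:
  assumes "(y, x) \<in> order X" "(z, x) \<in> order X"
  shows "(y, z) \<in> order X \<or> (z, y) \<in> order X"
proof -
  have "under (order X) x \<in> Chains (order X)"
    using forest order_points[OF assms(1)] unfolding based_forests_def finite_forest_def by blast
  then show ?thesis using assms unfolding Chains_def under_def by blast
qed

lemma finite_points: "finite (points X)"
  using forest unfolding based_forests_def finite_forest_def by blast

lemma base_subset: "U \<in> base X \<Longrightarrow> U \<subseteq> points X"
  using forest unfolding based_forests_def h_base_def upset_def by blast

lemma base_up: "U \<in> base X \<Longrightarrow> x \<in> U \<Longrightarrow> (x, y) \<in> order X \<Longrightarrow> y \<in> U"
  using forest unfolding based_forests_def h_base_def upset_def by blast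

lemma finite_base: "finite (base X)"
  using finite_points base_subset by (meson finite_Pow_iff finite_subset PowI subsetI)

lemma points_base: "points X \<in> base X"
  using forest unfolding based_forests_def by blast

lemma cone_base: "x \<in> points X \<Longrightarrow> up_gen (order X) {x} \<in> base X"
  using forest unfolding based_forests_def h_base_def by blast

lemma base_min: "U \<in> base X \<Longrightarrow> M \<subseteq> min_elems (order X) U \<Longrightarrow> up_gen (order X) M \<in> base X"
  using forest unfolding based_forests_def h_base_def by blast

lemma empty_base: "{} \<in> base X"
  using base_min[OF points_base, of "{}"] by (simp add: up_gen_def)

lemma min_below:
  assumes "U \<subseteq> points X" "x \<in> U"
  obtains m where "m \<in> min_elems (order X) U" "(m, x) \<in> order X"
proof -
  have "finite U" "(x, x) \<in> order X"
    using assms finite_points order_refl by (auto intro: finite_subset)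
  then show thesis
    using finite_min_below[OF _ trans_order antisym_order, of U x] that assms(2) by blast
qed

text \<open>
  Since \<open>U\<close> is an upset, a minimal element of \<open>V\<close> below a point of \<open>V \<setminus> U\<close> is outside \<open>U\<close>; thus
  \<open>[V \<setminus> U) = [V\<^sup>m \<setminus> U)\<close>.  This is the implication of the algebra of the forest.
\<close>

lemma diff_base:
  assumes U: "U \<in> base X" and V: "V \<in> base X"
  shows "up_gen (order X) (V - U) \<in> base X"
proof -
  have "y \<in> up_gen (order X) (min_elems (order X) V - U)"
    if x: "x \<in> V" "x \<notin> U" "(x, y) \<in> order X" for x y
  proof -
    obtain m where m: "m \<in> min_elems (order X) V" "(m, x) \<in> order X"
      using min_below base_subset[OF V] x(1) by blast
    then have "m \<notin> U" using base_up[OF U] x(2) by blast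
    then show ?thesis
      using m order_trans[OF m(2) x(3)] by (auto simp: up_gen_def)
  qed
  then have "up_gen (order X) (V - U) = up_gen (order X) (min_elems (order X) V - U)"
    by (auto simp: up_gen_def min_elems_def)
  then show ?thesis using base_min[OF V, of "min_elems (order X) V - U"] by auto
qed

end

section \<open>Open maps and chain-valued relations\<close>

lemma hFor_homD:
  assumes "f \<in> hFor_hom X Y"
  shows "f \<in> points X \<rightarrow>\<^sub>E points Y"
    and "x \<in> points X \<Longrightarrow> f x \<in> points Y"
    and "\<lbrakk>x \<in> points X; x' \<in> points X; (x, x') \<in> order X\<rbrakk> \<Longrightarrow> (f x, f x') \<in> order Y"
    and "\<lbrakk>x \<in> points X; y \<in> points Y; (y, f x) \<in> order Y\<rbrakk>
      \<Longrightarrow> \<exists>z\<in>points X. (z, x) \<in> order X \<and> f z = y"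
    and "U \<in> base Y \<Longrightarrow> f -` U \<inter> points X \<in> base X"
  using assms unfolding hFor_hom_def by (auto simp: PiE_mem)

lemma id_hFor_hom:
  assumes "X \<in> based_forests"
  shows "(\<lambda>x\<in>points X. x) \<in> hFor_hom X X"
proof -
  interpret forest X using assms by unfold_locales
  have "(\<lambda>x\<in>points X. x) -` U \<inter> points X = U" if "U \<in> base X" for U
    using base_subset[OF that] by auto
  then show ?thesis unfolding hFor_hom_def by auto
qed

lemma compose_hFor_hom:
  assumes f: "f \<in> hFor_hom X Y" and g: "g \<in> hFor_hom Y Z"
  shows "compose (points X) g f \<in> hFor_hom X Z"
proof -
  note F = hFor_homD[OF f] and G = hFor_homD[OF g]
  have "compose (points X) g f -` U \<inter> points X = f -` (g -` U \<inter> points Y) \<inter> points X" for U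
    using F(2) by (auto simp: compose_eq)
  then have "compose (points X) g f -` U \<inter> points X \<in> base X" if "U \<in> base Z" for U
    using F(5)[OF G(5)[OF that]] by simp
  moreover have "\<exists>z\<in>points X. (z, x) \<in> order X \<and> g (f z) = y"
    if "x \<in> points X" "y \<in> points Z" "(y, g (f x)) \<in> order Z" for x y
    using F(4)[OF that(1)] G(4)[OF F(2)[OF that(1)] that(2,3)] by metis
  moreover have "compose (points X) g f \<in> points X \<rightarrow>\<^sub>E points Z"
    using F(2) G(2) by (auto simp: compose_def)
  ultimately show ?thesis
    unfolding hFor_hom_def using F(2,3) G(3) by (auto simp: compose_eq)
qed

lemma category_hFor: "category hFor"
proof
  fix A B D E :: "'a based_forest" and f g h
  assume "f \<in> Hom hFor A B" "g \<in> Hom hFor B D" "h \<in> Hom hFor D E"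
  then show "Comp hFor A D E h (Comp hFor A B D g f) = Comp hFor A B E (Comp hFor B D E h g) f"
    using hFor_homD(1)[of f A B] by (auto simp: hFor_def PiE_def intro!: compose_assoc)
next
  fix A B D :: "'a based_forest" and f g
  assume "f \<in> Hom hFor A B" "g \<in> Hom hFor B D"
  then show "Comp hFor A B D g f \<in> Hom hFor A D"
    by (simp add: hFor_def compose_hFor_hom)
qed (auto simp: hFor_def id_hFor_hom PiE_def
    dest!: hFor_homD(1) intro!: compose_Id Id_compose)

definition hypograph :: "'a based_forest \<Rightarrow> 'a based_forest \<Rightarrow> ('a \<Rightarrow> 'a) \<Rightarrow> 'a rel" where
  "hypograph X Y f = {(x, y). x \<in> points X \<and> (y, f x) \<in> order Y}"

lemma hypograph_image: "x \<in> points X \<Longrightarrow> hypograph X Y f `` {x} = under (order Y) (f x)"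
  by (auto simp: hypograph_def under_def)

lemma hypograph_ChFor_hom:
  assumes "Y \<in> based_forests" and f: "f \<in> hFor_hom X Y"
  shows "hypograph X Y f \<in> ChFor_hom X Y"
proof -
  interpret Y: forest Y using assms by unfold_locales
  note F = hFor_homD[OF f]
  have "(hypograph X Y f)\<inverse> `` U = f -` U \<inter> points X" if "U \<in> base Y" for U
  proof
    show "(hypograph X Y f)\<inverse> `` U \<subseteq> f -` U \<inter> points X"
      using Y.base_up[OF that] by (auto simp: hypograph_def)
    show "f -` U \<inter> points X \<subseteq> (hypograph X Y f)\<inverse> `` U"
      using F(2) Y.order_refl by (auto simp: hypograph_def)
  qed
  then have "(hypograph X Y f)\<inverse> `` U \<in> base X" if "U \<in> base Y" for U
    using F(5) that by simp
  moreover have "\<exists>z\<in>points X. (z, x) \<in> order X \<and> hypograph X Y f `` {z} = under (order Y) y"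
    if "(x, y) \<in> hypograph X Y f" for x y
  proof -
    have "x \<in> points X" "(y, f x) \<in> order Y" using that by (auto simp: hypograph_def)
    then show ?thesis using F(4) Y.order_points hypograph_image by metis
  qed
  moreover have "hypograph X Y f `` {x} \<noteq> {} \<and> downset (points Y) (order Y) (hypograph X Y f `` {x})"
    if "x \<in> points X" for x
    unfolding hypograph_image[OF that] downset_def under_def
    using Y.order_refl[OF F(2)[OF that]] by (auto dest: Y.order_points Y.order_trans)
  moreover have "hypograph X Y f \<subseteq> points X \<times> points Y"
    using Y.order_points by (auto simp: hypograph_def)
  ultimately show ?thesis unfolding ChFor_hom_def by blast
qed

text \<open>
  Any two \<open>u, v \<in> R(x)\<close> are comparable: they are the greatest elements of \<open>R(z)\<close> and \<open>R(w)\<close> for some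
  \<open>z, w \<le> x\<close>, which are comparable in the forest \<open>X\<close>, and \<open>R\<close> is monotone.  So the maximal element
  of the finite set \<open>R(x)\<close> is its greatest element, and \<open>R(x)\<close> is a downset.
\<close>

lemma ChFor_hom_image_principal:
  assumes "X \<in> based_forests" "Y \<in> based_forests" and R: "R \<in> ChFor_hom X Y" and x: "x \<in> points X"
  shows "\<exists>y\<in>points Y. R `` {x} = under (order Y) y"
proof -
  interpret X: forest X using assms by unfold_locales
  interpret Y: forest Y using assms by unfold_locales
  have sub: "R \<subseteq> points X \<times> points Y" and ne: "R `` {x} \<noteq> {}"
    and down: "downset (points Y) (order Y) (R `` {x})"
    and rep: "\<And>x y. (x, y) \<in> R \<Longrightarrow> \<exists>z\<in>points X. (z, x) \<in> order X \<and> R `` {z} = under (order Y) y"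
    and pre: "\<And>U. U \<in> base Y \<Longrightarrow> R\<inverse> `` U \<in> base X"
    using R x unfolding ChFor_hom_def by blast+
  have down': "(x', v) \<in> R" if "(x', u) \<in> R" "(v, u) \<in> order Y" for x' u v
    using R that sub unfolding ChFor_hom_def downset_def by blast
  \<comment> \<open>Monotonicity comes from the h-base condition for \<open>[y)\<close>: its inverse image is an upset.\<close>
  have mono: "(w, y) \<in> R" if "(z, w) \<in> order X" "(z, y) \<in> R" for z w y
  proof -
    let ?U = "up_gen (order Y) {y}"
    have y: "y \<in> points Y" using sub that(2) by blast
    then have "z \<in> R\<inverse> `` ?U" using that(2) Y.order_refl by (auto simp: up_gen_def)
    then have "w \<in> R\<inverse> `` ?U" using X.base_up[OF pre[OF Y.cone_base[OF y]]] that(1) by blast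
    then show ?thesis using down' by (auto simp: up_gen_def)
  qed
  have chain: "(u, v) \<in> order Y \<or> (v, u) \<in> order Y" if u: "(x, u) \<in> R" and v: "(x, v) \<in> R" for u v
  proof -
    obtain z w where z: "(z, x) \<in> order X" "R `` {z} = under (order Y) u"
      and w: "(w, x) \<in> order X" "R `` {w} = under (order Y) v"
      using rep[OF u] rep[OF v] by blast
    have "(z, u) \<in> R" "(w, v) \<in> R"
      using z(2) w(2) u v sub Y.order_refl unfolding under_def by blast+
    then show ?thesis
      using X.comparable[OF z(1) w(1)] mono z(2) w(2) unfolding under_def by blast
  qed
  obtain y0 where y0: "(x, y0) \<in> R" using ne by blast
  have "finite (R `` {x})" using sub Y.finite_points by (auto intro: finite_subset)
  moreover have "antisym ((order Y)\<inverse>)" "trans ((order Y)\<inverse>)"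
    using Y.antisym_order Y.trans_order by simp_all
  moreover have "(y0, y0) \<in> (order Y)\<inverse>" using y0 sub Y.order_refl by blast
  ultimately obtain m where "m \<in> min_elems ((order Y)\<inverse>) (R `` {x})"
    using finite_min_below[of "R `` {x}" "(order Y)\<inverse>" y0] y0 by blast
  then have m: "(x, m) \<in> R" "\<And>y. (x, y) \<in> R \<Longrightarrow> (m, y) \<in> order Y \<Longrightarrow> y = m"
    by (auto simp: min_elems_def)
  then have "R `` {x} = under (order Y) m"
    using chain down' sub Y.order_refl unfolding under_def by blast
  then show ?thesis using m(1) sub by blast
qed

lemma bij_betw_hypograph:
  assumes "X \<in> based_forests" "Y \<in> based_forests"
  shows "bij_betw (hypograph X Y) (hFor_hom X Y) (ChFor_hom X Y)"
proof -
  interpret X: forest X using assms by unfold_locales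
  interpret Y: forest Y using assms by unfold_locales
  have inj: "f = g" if f: "f \<in> hFor_hom X Y" and g: "g \<in> hFor_hom X Y"
    and eq: "hypograph X Y f = hypograph X Y g" for f g
  proof (rule PiE_ext[OF hFor_homD(1)[OF f] hFor_homD(1)[OF g]])
    fix x assume x: "x \<in> points X"
    then have "under (order Y) (f x) = under (order Y) (g x)"
      using eq hypograph_image by metis
    then show "f x = g x"
      using Y.order_antisym Y.order_refl hFor_homD(2)[OF f x] hFor_homD(2)[OF g x]
      unfolding under_def by blast
  qed
  have surj: "R \<in> hypograph X Y ` hFor_hom X Y" if R: "R \<in> ChFor_hom X Y" for R
  proof -
    obtain f0 where f0: "\<And>x. x \<in> points X \<Longrightarrow> f0 x \<in> points Y \<and> R `` {x} = under (order Y) (f0 x)"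
      using ChFor_hom_image_principal[OF assms R] by metis
    define f where "f = restrict f0 (points X)"
    have f: "f x \<in> points Y" "R `` {x} = under (order Y) (f x)" if "x \<in> points X" for x
      using f0 that unfolding f_def by auto
    have sub: "R \<subseteq> points X \<times> points Y"
      and rep: "\<And>x y. (x, y) \<in> R \<Longrightarrow> \<exists>z\<in>points X. (z, x) \<in> order X \<and> R `` {z} = under (order Y) y"
      and pre: "\<And>U. U \<in> base Y \<Longrightarrow> R\<inverse> `` U \<in> base X"
      using R unfolding ChFor_hom_def by blast+
    have mem: "(x, y) \<in> R \<longleftrightarrow> (y, f x) \<in> order Y" if "x \<in> points X" for x y
      using f(2)[OF that] unfolding under_def by blast
    have pre_eq: "R\<inverse> `` U = f -` U \<inter> points X" if U: "U \<in> base Y" for U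
    proof
      show "R\<inverse> `` U \<subseteq> f -` U \<inter> points X"
        using mem sub Y.base_up[OF U] by blast
      show "f -` U \<inter> points X \<subseteq> R\<inverse> `` U"
        using mem f(1) Y.order_refl by blast
    qed
    have "(f x, f x') \<in> order Y" if "x \<in> points X" "x' \<in> points X" "(x, x') \<in> order X" for x x'
    proof -
      let ?U = "up_gen (order Y) {f x}"
      have "x \<in> f -` ?U \<inter> points X"
        using f(1) that(1) Y.order_refl by (auto simp: up_gen_def)
      then have "x' \<in> f -` ?U \<inter> points X"
        using X.base_up[OF _ _ that(3)] pre pre_eq Y.cone_base[OF f(1)[OF that(1)]] by metis
      then show ?thesis by (auto simp: up_gen_def)
    qed
    moreover have "\<exists>z\<in>points X. (z, x) \<in> order X \<and> f z = y"
      if x: "x \<in> points X" and y: "y \<in> points Y" "(y, f x) \<in> order Y" for x y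
    proof -
      have "(x, y) \<in> R" using mem x y by blast
      then obtain z where z: "z \<in> points X" "(z, x) \<in> order X" "R `` {z} = under (order Y) y"
        using rep by blast
      then have "under (order Y) (f z) = under (order Y) y" using f(2) by simp
      then have "f z = y"
        using Y.order_antisym Y.order_refl f(1)[OF z(1)] y(1) unfolding under_def by blast
      then show ?thesis using z by blast
    qed
    moreover have "f -` U \<inter> points X \<in> base X" if "U \<in> base Y" for U
      using pre[OF that] pre_eq[OF that] by simp
    moreover have "f \<in> points X \<rightarrow>\<^sub>E points Y" using f(1) by (auto simp: f_def)
    ultimately have "f \<in> hFor_hom X Y" unfolding hFor_hom_def by blast
    moreover have "R = hypograph X Y f"
      using mem sub by (auto simp: hypograph_def)
    ultimately show ?thesis by blast
  qed
  have "inj_on (hypograph X Y) (hFor_hom X Y)"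
    by (rule inj_onI) (rule inj)
  moreover have "hypograph X Y ` hFor_hom X Y = ChFor_hom X Y"
    using hypograph_ChFor_hom[OF assms(2)] surj by (intro subset_antisym subsetI) auto
  ultimately show ?thesis unfolding bij_betw_def ..
qed

theorem ChFor_isomorphic_hFor:
  "isomorphic_categories
    (ChFor :: ('a based_forest, 'a rel) category_data)
    (hFor :: ('a based_forest, 'a \<Rightarrow> 'a) category_data)"
proof (rule isomorphic_categories_of_bij_homs[where \<phi> = hypograph])
  fix A :: "'a based_forest" assume "A \<in> Obj hFor"
  then interpret forest A by unfold_locales (simp add: hFor_def)
  show "hypograph A A (Ident hFor A) = Ident ChFor A"
    using order_points by (auto simp: hypograph_def hFor_def ChFor_def)
next
  fix A B E :: "'a based_forest" and f g
  assume *: "A \<in> Obj hFor" "B \<in> Obj hFor" "E \<in> Obj hFor" "f \<in> Hom hFor A B" "g \<in> Hom hFor B E"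
  interpret B: forest B using * by unfold_locales (simp add: hFor_def)
  interpret E: forest E using * by unfold_locales (simp add: hFor_def)
  have f: "f \<in> hFor_hom A B" and g: "g \<in> hFor_hom B E" using * by (simp_all add: hFor_def)
  have "hypograph A E (compose (points A) g f) = hypograph A B f O hypograph B E g"
  proof (intro subset_antisym subrelI)
    fix x z assume "(x, z) \<in> hypograph A E (compose (points A) g f)"
    then have x: "x \<in> points A" and z: "(z, g (f x)) \<in> order E"
      by (auto simp: hypograph_def compose_eq)
    then have "(x, f x) \<in> hypograph A B f" "(f x, z) \<in> hypograph B E g"
      using hFor_homD(2)[OF f x] B.order_refl by (auto simp: hypograph_def)
    then show "(x, z) \<in> hypograph A B f O hypograph B E g" by blast
  next
    fix x z assume "(x, z) \<in> hypograph A B f O hypograph B E g"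
    then obtain y where y: "x \<in> points A" "(y, f x) \<in> order B" "(z, g y) \<in> order E"
      by (auto simp: hypograph_def)
    then have "(g y, g (f x)) \<in> order E"
      using hFor_homD(3)[OF g] B.order_points by blast
    then show "(x, z) \<in> hypograph A E (compose (points A) g f)"
      using y E.order_trans[OF y(3)] by (simp add: hypograph_def compose_eq)
  qed
  then show "hypograph A E (Comp hFor A B E g f) =
      Comp ChFor A B E (hypograph B E g) (hypograph A B f)"
    by (simp add: hFor_def ChFor_def)
next
  show "category (hFor :: ('a based_forest, 'a \<Rightarrow> 'a) category_data)"
    by (rule category_hFor)
next
  show "Obj (ChFor :: ('a based_forest, 'a rel) category_data) = Obj (hFor :: ('a based_forest, 'a \<Rightarrow> 'a) category_data)"
    by (simp add: hFor_def ChFor_def)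
next
  fix A B :: "'a based_forest"
  assume "A \<in> Obj hFor" "B \<in> Obj hFor"
  then show "bij_betw (hypograph A B) (Hom hFor A B) (Hom ChFor A B)"
    by (simp add: hFor_def ChFor_def bij_betw_hypograph)
qed

section \<open>Algebras represented on a forest\<close>

text \<open>
  An algebra \<open>H\<close> together with an isomorphism \<open>\<sigma>\<close> onto the algebra of the h-base of \<open>X\<close>.  Working
  with \<open>\<sigma>\<close> instead of that algebra itself serves two kinds of algebras at once: copies of an
  h-base inside another type, and given algebras represented on their irreducible elements.
\<close>

locale representation = forest X + imp_algebra H
  for X :: "'a based_forest" and H :: "'b bhilbert" +
  fixes \<sigma> :: "'b \<Rightarrow> 'a set"
  assumes rep_bij: "bij_betw \<sigma> (carrier H) (base X)"
    and zero_in: "zero H \<in> carrier H"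
    and rep_zero: "\<sigma> (zero H) = points X"
    and rep_one: "\<sigma> (one H) = {}"
    and rep_imp: "\<lbrakk>a \<in> carrier H; b \<in> carrier H\<rbrakk>
      \<Longrightarrow> \<sigma> (imp H a b) = up_gen (order X) (\<sigma> b - \<sigma> a)"
begin

lemma rep_base: "a \<in> carrier H \<Longrightarrow> \<sigma> a \<in> base X"
  using rep_bij by (auto simp: bij_betw_def)

lemma rep_inject: "\<lbrakk>\<sigma> a = \<sigma> b; a \<in> carrier H; b \<in> carrier H\<rbrakk> \<Longrightarrow> a = b"
  using rep_bij by (auto simp: bij_betw_def inj_on_def)

lemma rep_inv:
  assumes "U \<in> base X"
  shows "inv_into (carrier H) \<sigma> U \<in> carrier H" "\<sigma> (inv_into (carrier H) \<sigma> U) = U"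
  using rep_bij assms by (auto simp: bij_betw_def inv_into_into f_inv_into_f)

lemma rep_obtain:
  assumes "U \<in> base X"
  obtains a where "a \<in> carrier H" "\<sigma> a = U"
  using rep_inv[OF assms] that by blast

lemma rep_points: "a \<in> carrier H \<Longrightarrow> x \<in> \<sigma> a \<Longrightarrow> x \<in> points X"
  using base_subset[OF rep_base] by blast

lemma rep_up: "\<lbrakk>a \<in> carrier H; x \<in> \<sigma> a; (x, y) \<in> order X\<rbrakk> \<Longrightarrow> y \<in> \<sigma> a"
  using base_up[OF rep_base] by blast

lemma mem_rep_imp: "\<lbrakk>a \<in> carrier H; b \<in> carrier H\<rbrakk> \<Longrightarrow>
    z \<in> \<sigma> (imp H a b) \<longleftrightarrow> (\<exists>y. (y, z) \<in> order X \<and> y \<in> \<sigma> b \<and> y \<notin> \<sigma> a)"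
  by (auto simp: rep_imp up_gen_def)

lemma rep_impI: "\<lbrakk>a \<in> carrier H; b \<in> carrier H; z \<in> \<sigma> b; z \<notin> \<sigma> a\<rbrakk> \<Longrightarrow> z \<in> \<sigma> (imp H a b)"
  using mem_rep_imp order_refl rep_points by blast

lemma rep_imp_subset: "\<lbrakk>a \<in> carrier H; b \<in> carrier H\<rbrakk> \<Longrightarrow> \<sigma> (imp H a b) \<subseteq> \<sigma> b"
  using mem_rep_imp rep_up by blast

lemma imp_eq_one_iff:
  assumes "a \<in> carrier H" "b \<in> carrier H"
  shows "imp H a b = one H \<longleftrightarrow> \<sigma> b \<subseteq> \<sigma> a"
proof
  assume "imp H a b = one H"
  then show "\<sigma> b \<subseteq> \<sigma> a" using rep_impI[OF assms] rep_one by auto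
next
  assume "\<sigma> b \<subseteq> \<sigma> a"
  then have "\<sigma> (imp H a b) = \<sigma> (one H)" using mem_rep_imp[OF assms] rep_one by auto
  then show "imp H a b = one H" using assms imp_closed one_closed rep_inject by blast
qed

lemma is_hilbert_algebra: "hilbert_algebra H"
proof
  fix a b assume *: "a \<in> carrier H" "b \<in> carrier H"
  then show "imp H a (imp H b a) = one H"
    by (simp add: imp_eq_one_iff imp_closed rep_imp_subset)
next
  fix a b c assume *: "a \<in> carrier H" "b \<in> carrier H" "c \<in> carrier H"
  have "z \<in> \<sigma> (imp H a (imp H b c))"
    if z: "z \<in> \<sigma> (imp H (imp H a b) (imp H a c))" for z
  proof -
    obtain y where y: "(y, z) \<in> order X" "y \<in> \<sigma> (imp H a c)" "y \<notin> \<sigma> (imp H a b)"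
      using z * mem_rep_imp[OF imp_closed[of a b] imp_closed[of a c]] by auto
    then obtain w where w: "(w, y) \<in> order X" "w \<in> \<sigma> c" "w \<notin> \<sigma> a"
      using * by (auto simp: mem_rep_imp)
    then have "w \<notin> \<sigma> b" using y(3) * by (auto simp: mem_rep_imp)
    then have "w \<in> \<sigma> (imp H b c)" using w * by (intro rep_impI) auto
    then show ?thesis
      using w order_trans[OF w(1) y(1)] * by (auto simp: mem_rep_imp imp_closed)
  qed
  then show "imp H (imp H a (imp H b c)) (imp H (imp H a b) (imp H a c)) = one H"
    using * by (auto simp: imp_eq_one_iff imp_closed)
next
  fix a b assume "a \<in> carrier H" "b \<in> carrier H" "imp H a b = one H" "imp H b a = one H"
  then show "a = b" using imp_eq_one_iff rep_inject by blast
qed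

text \<open>
  As \<open>(x]\<close> is a finite chain, this upset is empty or of the form \<open>[z)\<close> with \<open>z \<le> x\<close>.
\<close>

definition branch_part :: "'a \<Rightarrow> 'a set \<Rightarrow> 'a set" where
  "branch_part x U = up_gen (order X) (U \<inter> under (order X) x)"

lemma mem_branch_part:
  "z \<in> branch_part x U \<longleftrightarrow> (\<exists>y\<in>U. (y, x) \<in> order X \<and> (y, z) \<in> order X)"
  by (auto simp: branch_part_def up_gen_def under_def)

lemma branch_part_base:
  assumes U: "U \<in> base X"
  shows "branch_part x U \<in> base X"
proof -
  have "z \<in> up_gen (order X) (min_elems (order X) U \<inter> under (order X) x)"
    if y: "y \<in> U" "(y, x) \<in> order X" "(y, z) \<in> order X" for y z
  proof -
    obtain m where "m \<in> min_elems (order X) U" "(m, y) \<in> order X"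
      using min_below[OF base_subset[OF U] y(1)] .
    then show ?thesis
      using order_trans y(2,3) unfolding up_gen_def under_def by blast
  qed
  then have "branch_part x U = up_gen (order X) (min_elems (order X) U \<inter> under (order X) x)"
    by (auto simp: branch_part_def up_gen_def min_elems_def under_def)
  then show ?thesis using base_min[OF U] by (metis inf_le1)
qed

lemma branch_part_subset: "U \<in> base X \<Longrightarrow> branch_part x U \<subseteq> U"
  using base_up by (auto simp: mem_branch_part)

lemma branch_part_idem: "branch_part x (branch_part x U) = branch_part x U"
proof (intro set_eqI iffI)
  fix z assume "z \<in> branch_part x (branch_part x U)"
  then obtain y w where "w \<in> U" "(w, x) \<in> order X" "(w, y) \<in> order X" "(y, z) \<in> order X"
    by (auto simp: mem_branch_part)
  then show "z \<in> branch_part x U"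
    unfolding mem_branch_part using order_trans by blast
next
  fix z assume "z \<in> branch_part x U"
  then obtain y where y: "y \<in> U" "(y, x) \<in> order X" "(y, z) \<in> order X"
    by (auto simp: mem_branch_part)
  moreover have "(y, y) \<in> order X" using order_refl order_points[OF y(2)] by blast
  ultimately have "y \<in> branch_part x U"
    unfolding mem_branch_part by blast
  then show "z \<in> branch_part x (branch_part x U)"
    using y unfolding mem_branch_part[of z x "branch_part x U"] by blast
qed

text \<open>
  The variety is generated by the chains over the type of \<open>H\<close>, so the chain to which \<open>H\<close> is mapped
  is taken as a subalgebra of \<open>H\<close> itself.
\<close>

definition branch_chain :: "'a \<Rightarrow> 'b hilbert" where
  "branch_chain x =
    \<lparr>carrier = {c \<in> carrier H. branch_part x (\<sigma> c) = \<sigma> c}, imp = imp H, one = one H\<rparr>"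

text \<open>
  The map \<open>U \<mapsto> [U \<inter> (x])\<close> is a homomorphism because a point of \<open>V \<setminus> U\<close> below a point of \<open>(x]\<close>
  lies itself in \<open>(x]\<close>.
\<close>

lemma branch_part_imp:
  assumes "a \<in> carrier H" "b \<in> carrier H"
  shows "branch_part x (\<sigma> (imp H a b)) =
    up_gen (order X) (branch_part x (\<sigma> b) - branch_part x (\<sigma> a))"
proof (intro set_eqI iffI)
  fix z assume "z \<in> branch_part x (\<sigma> (imp H a b))"
  then obtain y w where y: "(y, x) \<in> order X" "(y, z) \<in> order X"
    and w: "(w, y) \<in> order X" "w \<in> \<sigma> b" "w \<notin> \<sigma> a"
    using assms by (auto simp: mem_branch_part mem_rep_imp)
  have "w \<in> branch_part x (\<sigma> b)"
    using w y order_trans order_refl order_points unfolding mem_branch_part by blast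
  moreover have "w \<notin> branch_part x (\<sigma> a)"
    using w branch_part_subset rep_base assms by blast
  ultimately show "z \<in> up_gen (order X) (branch_part x (\<sigma> b) - branch_part x (\<sigma> a))"
    using order_trans[OF w(1) y(2)] by (auto simp: up_gen_def)
next
  fix z assume "z \<in> up_gen (order X) (branch_part x (\<sigma> b) - branch_part x (\<sigma> a))"
  then obtain y w where y: "(y, z) \<in> order X" "y \<notin> branch_part x (\<sigma> a)"
    and w: "w \<in> \<sigma> b" "(w, x) \<in> order X" "(w, y) \<in> order X"
    by (auto simp: up_gen_def mem_branch_part)
  then have "w \<notin> \<sigma> a" by (auto simp: mem_branch_part)
  then have "w \<in> \<sigma> (imp H a b)" using w assms by (intro rep_impI)
  then show "z \<in> branch_part x (\<sigma> (imp H a b))"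
    using w order_trans[OF w(3) y(1)] by (auto simp: mem_branch_part)
qed

text \<open>
  If two elements were incomparable, each of the two upsets would have a point of \<open>(x]\<close> outside
  the other, which is impossible as these two points are comparable.
\<close>

lemma hilbert_chain_branch_chain: "hilbert_chain (branch_chain x)"
proof -
  interpret H: hilbert_algebra H by (rule is_hilbert_algebra)
  have closed: "branch_part x (\<sigma> (imp H a b)) = \<sigma> (imp H a b)"
    if "a \<in> carrier H" "b \<in> carrier H" "branch_part x (\<sigma> a) = \<sigma> a" "branch_part x (\<sigma> b) = \<sigma> b" for a b
    using that branch_part_imp[of a b x] rep_imp[of a b] by simp
  have "branch_part x (\<sigma> (one H)) = \<sigma> (one H)"
    by (auto simp: rep_one mem_branch_part)
  then have "hilbert_algebra (branch_chain x)"
    using H.imp_K H.imp_S H.imp_antisym one_closed imp_closed closed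
    by unfold_locales (simp_all add: branch_chain_def)
  moreover have "nat_le (branch_chain x) a b \<or> nat_le (branch_chain x) b a"
    if "a \<in> carrier (branch_chain x)" "b \<in> carrier (branch_chain x)" for a b
  proof (rule ccontr)
    have a: "a \<in> carrier H" "branch_part x (\<sigma> a) = \<sigma> a"
      and b: "b \<in> carrier H" "branch_part x (\<sigma> b) = \<sigma> b"
      using that by (auto simp: branch_chain_def)
    assume "\<not> (nat_le (branch_chain x) a b \<or> nat_le (branch_chain x) b a)"
    then obtain u v where "u \<in> \<sigma> a" "u \<notin> \<sigma> b" "v \<in> \<sigma> b" "v \<notin> \<sigma> a"
      using a b by (auto simp: nat_le_def branch_chain_def imp_eq_one_iff)
    moreover then obtain u' v' where "u' \<in> \<sigma> a" "(u', x) \<in> order X" "(u', u) \<in> order X"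
      "v' \<in> \<sigma> b" "(v', x) \<in> order X" "(v', v) \<in> order X"
      using a(2) b(2) mem_branch_part by metis
    ultimately show False
      using comparable[of u' x v'] rep_up[OF a(1)] rep_up[OF b(1)] by blast
  qed
  ultimately show ?thesis unfolding hilbert_chain_def by blast
qed

text \<open>
  The retractions \<open>\<phi> x\<close> onto the chains preserve values of terms, and jointly they are injective,
  since \<open>x\<close> lies in \<open>U\<close> if and only if it lies in \<open>[U \<inter> (x])\<close>.  So \<open>H\<close> is a subdirect product of
  chains, and an identity valid in all chains is valid in \<open>H\<close>.
\<close>

lemma in_variety_of_chains_H: "in_variety_of_chains H"
proof -
  define \<phi> where "\<phi> = (\<lambda>x a. inv_into (carrier H) \<sigma> (branch_part x (\<sigma> a)))"
  have \<phi>: "\<phi> x a \<in> carrier H" "\<sigma> (\<phi> x a) = branch_part x (\<sigma> a)" if "a \<in> carrier H" for x a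
    using rep_inv[OF branch_part_base[OF rep_base[OF that]]] unfolding \<phi>_def by auto
  have \<phi>_chain: "\<phi> x a \<in> carrier (branch_chain x)" if "a \<in> carrier H" for x a
    using \<phi>[OF that] by (simp add: branch_chain_def branch_part_idem)
  have \<phi>_one: "\<phi> x (one H) = one H" for x
    using \<phi>[OF one_closed] one_closed by (intro rep_inject) (auto simp: rep_one mem_branch_part)
  have \<phi>_imp: "\<phi> x (imp H a b) = imp H (\<phi> x a) (\<phi> x b)" if "a \<in> carrier H" "b \<in> carrier H" for x a b
    using that \<phi> imp_closed rep_imp[of "\<phi> x a" "\<phi> x b"]
    by (intro rep_inject) (simp_all add: branch_part_imp)
  have val_closed: "imp_term_val H v t \<in> carrier H" if "range v \<subseteq> carrier H" for v t
    using that by (induction t) (auto simp: one_closed imp_closed)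
  have val: "imp_term_val (branch_chain x) (\<lambda>n. \<phi> x (v n)) t = \<phi> x (imp_term_val H v t)"
    if "range v \<subseteq> carrier H" for v t x
  proof (induction t)
    case (Imp s t)
    then show ?case using that by (simp add: branch_chain_def \<phi>_imp val_closed)
  qed (simp_all add: branch_chain_def \<phi>_one)
  have "imp_term_val H v s = imp_term_val H v t"
    if E: "\<forall>C :: 'b hilbert. hilbert_chain C \<longrightarrow> models_identities C E"
      and st: "(s, t) \<in> E" and v: "range v \<subseteq> carrier H" for E v s t
  proof (rule rep_inject)
    have "branch_part x (\<sigma> (imp_term_val H v s)) = branch_part x (\<sigma> (imp_term_val H v t))" for x
    proof -
      have "range (\<lambda>n. \<phi> x (v n)) \<subseteq> carrier (branch_chain x)"
        using v \<phi>_chain by auto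
      then have "imp_term_val (branch_chain x) (\<lambda>n. \<phi> x (v n)) s =
          imp_term_val (branch_chain x) (\<lambda>n. \<phi> x (v n)) t"
        using E st hilbert_chain_branch_chain[of x] unfolding models_identities_def by blast
      then show ?thesis using v \<phi>(2) val_closed by (metis val)
    qed
    moreover have "x \<in> branch_part x (\<sigma> c) \<longleftrightarrow> x \<in> \<sigma> c" if "c \<in> carrier H" for x c
      using rep_up[OF that] order_refl[OF rep_points[OF that], of x]
      by (auto simp: mem_branch_part)
    ultimately show "\<sigma> (imp_term_val H v s) = \<sigma> (imp_term_val H v t)"
      using val_closed[OF v] by blast
  qed (use v val_closed in auto)
  then have "models_identities H E"
    if "\<forall>C :: 'b hilbert. hilbert_chain C \<longrightarrow> models_identities C E" for E
    unfolding models_identities_def[of H] using that by auto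
  then show ?thesis
    unfolding in_variety_of_chains_def using imp_algebra_axioms by simp
qed

lemma represented_in_fPHil0: "H \<in> Obj fPHil0"
proof -
  interpret H: hilbert_algebra H by (rule is_hilbert_algebra)
  have "bounded_prelinear_hilbert_algebra H"
    using in_variety_of_chains_H zero_in base_subset[OF rep_base]
    by unfold_locales (simp_all add: nat_le_def imp_eq_one_iff rep_zero)
  moreover have "finite (carrier H)"
    using rep_bij finite_base bij_betw_finite by blast
  ultimately show ?thesis by (simp add: fPHil0_def)
qed

end

section \<open>Homomorphisms are inverse images along open maps\<close>

lemma bhilbert_homD:
  assumes "h \<in> bhilbert_hom H K"
  shows "h \<in> carrier H \<rightarrow>\<^sub>E carrier K"
    and "a \<in> carrier H \<Longrightarrow> h a \<in> carrier K"
    and "\<lbrakk>a \<in> carrier H; b \<in> carrier H\<rbrakk> \<Longrightarrow> h (imp H a b) = imp K (h a) (h b)"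
    and "h (one H) = one K" "h (zero H) = zero K"
  using assms unfolding bhilbert_hom_def by auto

text \<open>
  The homomorphism \<open>U \<mapsto> f\<^sup>-\<^sup>1(U)\<close>, transported along the representations \<open>\<sigma>\<close> of \<open>H\<close> and \<open>\<tau>\<close> of \<open>K\<close>.
\<close>

definition pullback where
  "pullback X H \<sigma> K \<tau> f = (\<lambda>a\<in>carrier K. inv_into (carrier H) \<sigma> (f -` \<tau> a \<inter> points X))"

locale representation_pair =
  X: representation X H \<sigma> + Y: representation Y K \<tau>
  for X :: "'a based_forest" and H :: "'b bhilbert" and \<sigma>
    and Y :: "'a based_forest" and K :: "'b bhilbert" and \<tau>
begin

lemma rep_pullback:
  assumes f: "f \<in> hFor_hom X Y" and a: "a \<in> carrier K"
  shows "pullback X H \<sigma> K \<tau> f a \<in> carrier H"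
    "\<sigma> (pullback X H \<sigma> K \<tau> f a) = f -` \<tau> a \<inter> points X"
  using X.rep_inv[OF hFor_homD(5)[OF f Y.rep_base[OF a]]] a by (simp_all add: pullback_def)

text \<open>
  Openness of \<open>f\<close> is what makes implication be preserved: a point of \<open>V \<setminus> U\<close> below \<open>f x\<close> lifts to a
  point below \<open>x\<close>.
\<close>

lemma pullback_hom:
  assumes f: "f \<in> hFor_hom X Y"
  shows "pullback X H \<sigma> K \<tau> f \<in> bhilbert_hom K H" (is "?h \<in> _")
proof -
  note F = hFor_homD[OF f] and h = rep_pullback[OF f]
  have "?h \<in> carrier K \<rightarrow>\<^sub>E carrier H"
    using h(1) by (auto simp: pullback_def)
  moreover have "?h (imp K a b) = imp H (?h a) (?h b)" if ab: "a \<in> carrier K" "b \<in> carrier K" for a b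
  proof (rule X.rep_inject)
    have "x \<in> \<sigma> (?h (imp K a b)) \<longleftrightarrow> x \<in> \<sigma> (imp H (?h a) (?h b))" for x
    proof
      assume "x \<in> \<sigma> (?h (imp K a b))"
      then have x: "x \<in> points X" "f x \<in> \<tau> (imp K a b)"
        using ab by (simp_all add: h(2) Y.imp_closed)
      then obtain y where y: "(y, f x) \<in> order Y" "y \<in> \<tau> b" "y \<notin> \<tau> a"
        using ab by (auto simp: Y.mem_rep_imp)
      then obtain z where "z \<in> points X" "(z, x) \<in> order X" "f z = y"
        using F(4)[OF x(1)] Y.order_points by blast
      then show "x \<in> \<sigma> (imp H (?h a) (?h b))"
        using y ab by (auto simp: X.mem_rep_imp h)
    next
      assume "x \<in> \<sigma> (imp H (?h a) (?h b))"
      then obtain z where "(z, x) \<in> order X" "z \<in> points X" "f z \<in> \<tau> b" "f z \<notin> \<tau> a"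
        using ab by (auto simp: X.mem_rep_imp h)
      moreover then have "x \<in> points X" using X.order_points by blast
      ultimately show "x \<in> \<sigma> (?h (imp K a b))"
        using ab F(3) by (auto simp: h Y.imp_closed Y.mem_rep_imp)
    qed
    then show "\<sigma> (?h (imp K a b)) = \<sigma> (imp H (?h a) (?h b))" by blast
  qed (use ab h X.imp_closed Y.imp_closed in auto)
  moreover have "?h (one K) = one H"
    using h[OF Y.one_closed] X.one_closed by (intro X.rep_inject) (auto simp: X.rep_one Y.rep_one)
  moreover have "?h (zero K) = zero H"
    using h[OF Y.zero_in] X.zero_in F(2)
    by (intro X.rep_inject) (auto simp: X.rep_zero Y.rep_zero)
  ultimately show ?thesis unfolding bhilbert_hom_def by blast
qed

lemma pullback_eqI:
  assumes f: "f \<in> hFor_hom X Y" and h: "h \<in> bhilbert_hom K H"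
    and eq: "\<And>a. a \<in> carrier K \<Longrightarrow> \<sigma> (h a) = f -` \<tau> a \<inter> points X"
  shows "h = pullback X H \<sigma> K \<tau> f"
proof (rule ext)
  fix a
  have h: "h \<in> carrier K \<rightarrow>\<^sub>E carrier H" using h unfolding bhilbert_hom_def by blast
  show "h a = pullback X H \<sigma> K \<tau> f a"
  proof (cases "a \<in> carrier K")
    case True
    then show ?thesis
      using eq[OF True] rep_pullback[OF f True] PiE_mem[OF h True] by (intro X.rep_inject) simp_all
  next
    case False
    then show ?thesis using PiE_arb[OF h False] by (simp add: pullback_def)
  qed
qed

text \<open>
  If \<open>f\<close> and \<open>g\<close> have the same inverse images, then \<open>x \<in> f\<^sup>-\<^sup>1([f x)) = g\<^sup>-\<^sup>1([f x))\<close>, that is,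
  \<open>f x \<le> g x\<close>, and symmetrically.
\<close>

lemma inj_on_pullback: "inj_on (pullback X H \<sigma> K \<tau>) (hFor_hom X Y)"
proof (rule inj_onI)
  have le: "(f x, g x) \<in> order Y"
    if f: "f \<in> hFor_hom X Y" and g: "g \<in> hFor_hom X Y" and x: "x \<in> points X"
      and eq: "pullback X H \<sigma> K \<tau> f = pullback X H \<sigma> K \<tau> g" for f g x
  proof -
    have fx: "f x \<in> points Y" using hFor_homD(2)[OF f x] .
    then obtain a where a: "a \<in> carrier K" "\<tau> a = up_gen (order Y) {f x}"
      using Y.rep_obtain Y.cone_base by metis
    then have "x \<in> f -` \<tau> a \<inter> points X" using x Y.order_refl[OF fx] by (auto simp: up_gen_def)
    then have "x \<in> g -` \<tau> a \<inter> points X"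
      using rep_pullback(2)[OF f a(1)] rep_pullback(2)[OF g a(1)] eq by simp
    then show ?thesis using a(2) by (auto simp: up_gen_def)
  qed
  fix f g
  assume "f \<in> hFor_hom X Y" "g \<in> hFor_hom X Y" "pullback X H \<sigma> K \<tau> f = pullback X H \<sigma> K \<tau> g"
  then show "f = g"
    using PiE_ext[OF hFor_homD(1) hFor_homD(1)] le Y.order_antisym by metis
qed

text \<open>
  Let \<open>D\<close> be the set of \<open>a\<close> with \<open>x \<in> h(a)\<close>.  It contains \<open>0\<close>, and being finite it has an element \<open>a\<close>
  for which \<open>\<tau> a\<close> is minimal.  This \<open>a\<close> is least.  For let \<open>b \<in> D\<close>.  As \<open>(x]\<close> is a chain, \<open>x\<close> is
  not in both \<open>h(a \<rightarrow> b)\<close> and \<open>h(b \<rightarrow> a)\<close>.  If \<open>x \<notin> h(b \<rightarrow> a)\<close>, then \<open>c = (b \<rightarrow> a) \<rightarrow> a\<close> is in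
  \<open>D\<close>; if \<open>x \<notin> h(a \<rightarrow> b)\<close>, then \<open>c = (a \<rightarrow> b) \<rightarrow> b\<close> is in \<open>D\<close>.  In both cases \<open>\<tau> c\<close> is contained in
  \<open>\<tau> a\<close> and in \<open>\<tau> b\<close>, and minimality gives \<open>\<tau> c = \<tau> a\<close>.
\<close>

lemma hom_least_preimage:
  assumes h: "h \<in> bhilbert_hom K H" and x: "x \<in> points X"
  shows "\<exists>a\<in>carrier K. x \<in> \<sigma> (h a) \<and> (\<forall>b\<in>carrier K. x \<in> \<sigma> (h b) \<longrightarrow> \<tau> a \<subseteq> \<tau> b)"
proof -
  note hD = bhilbert_homD(2-5)[OF h]
  let ?D = "{a \<in> carrier K. x \<in> \<sigma> (h a)}"
  have "zero K \<in> ?D" using Y.zero_in hD(4) X.rep_zero x by simp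
  moreover have "finite (\<tau> ` ?D)"
    using Y.finite_base Y.rep_base by (auto intro: finite_subset)
  ultimately obtain U where "U \<in> \<tau> ` ?D" "\<forall>V\<in>\<tau> ` ?D. V \<subseteq> U \<longrightarrow> U = V"
    using finite_has_minimal[of "\<tau> ` ?D"] by auto
  then obtain a where a: "a \<in> carrier K" "x \<in> \<sigma> (h a)"
    and minimal: "\<And>b. \<lbrakk>b \<in> carrier K; x \<in> \<sigma> (h b); \<tau> b \<subseteq> \<tau> a\<rbrakk> \<Longrightarrow> \<tau> b = \<tau> a"
    by auto
  have "\<tau> a \<subseteq> \<tau> b" if b: "b \<in> carrier K" "x \<in> \<sigma> (h b)" for b
  proof -
    have h_imp: "x \<in> \<sigma> (h (imp K c d))"
      if "c \<in> carrier K" "d \<in> carrier K" "x \<in> \<sigma> (h d)" "x \<notin> \<sigma> (h c)" for c d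
      using that hD by (simp add: X.rep_impI)
    consider "x \<notin> \<sigma> (h (imp K b a))" | "x \<notin> \<sigma> (h (imp K a b))"
    proof -
      have False if *: "x \<in> \<sigma> (h (imp K b a))" "x \<in> \<sigma> (h (imp K a b))"
      proof -
        obtain u where u: "(u, x) \<in> order X" "u \<in> \<sigma> (h a)" "u \<notin> \<sigma> (h b)"
          using * a b hD by (auto simp: X.mem_rep_imp)
        obtain v where v: "(v, x) \<in> order X" "v \<in> \<sigma> (h b)" "v \<notin> \<sigma> (h a)"
          using * a b hD by (auto simp: X.mem_rep_imp)
        show False
          using X.comparable[OF u(1) v(1)] X.rep_up hD(1) a(1) b(1) u v by blast
      qed
      then show thesis using that by blast
    qed
    then show ?thesis
    proof cases
      case 1
      let ?c = "imp K (imp K b a) a"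
      have c: "?c \<in> carrier K" "x \<in> \<sigma> (h ?c)"
        using 1 a b by (auto intro: h_imp Y.imp_closed)
      have "\<tau> ?c \<subseteq> \<tau> b"
      proof
        fix z assume "z \<in> \<tau> ?c"
        then obtain y where "(y, z) \<in> order Y" "y \<in> \<tau> a" "y \<notin> \<tau> (imp K b a)"
          using a b by (auto simp: Y.mem_rep_imp Y.imp_closed)
        moreover then have "y \<in> \<tau> b" using a b Y.rep_impI by blast
        ultimately show "z \<in> \<tau> b" using b Y.rep_up by blast
      qed
      moreover have "\<tau> ?c = \<tau> a"
        using minimal[OF c] Y.rep_imp_subset a b Y.imp_closed by blast
      ultimately show ?thesis by simp
    next
      case 2
      let ?c = "imp K (imp K a b) b"
      have c: "?c \<in> carrier K" "x \<in> \<sigma> (h ?c)"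
        using 2 a b by (auto intro: h_imp Y.imp_closed)
      have "\<tau> ?c \<subseteq> \<tau> a"
      proof
        fix z assume "z \<in> \<tau> ?c"
        then obtain y where "(y, z) \<in> order Y" "y \<in> \<tau> b" "y \<notin> \<tau> (imp K a b)"
          using a b by (auto simp: Y.mem_rep_imp Y.imp_closed)
        moreover then have "y \<in> \<tau> a" using a b Y.rep_impI by blast
        ultimately show "z \<in> \<tau> a" using a Y.rep_up by blast
      qed
      then have "\<tau> a = \<tau> ?c" using minimal[OF c] by blast
      also have "\<dots> \<subseteq> \<tau> b" using a b Y.imp_closed Y.rep_imp_subset by blast
      finally show ?thesis .
    qed
  qed
  then show ?thesis using a by blast
qed

text \<open>
  The least \<open>\<tau> a\<close> with \<open>x \<in> h(a)\<close> is nonempty since \<open>h(1) = 1\<close>.  Let \<open>y\<close> be a minimal element of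
  \<open>\<tau> a\<close> and \<open>\<tau> b = [y)\<close>.  If \<open>x \<notin> h(b)\<close>, then \<open>x \<in> h(b \<rightarrow> a)\<close>, so \<open>\<tau> a\<close> is contained in
  \<open>\<tau> (b \<rightarrow> a)\<close>, although \<open>y\<close> is not in the latter.  So \<open>x \<in> h(b)\<close>, and \<open>\<tau> a = [y)\<close> follows.
\<close>

lemma hom_dual_point:
  assumes h: "h \<in> bhilbert_hom K H" and x: "x \<in> points X"
  shows "\<exists>y\<in>points Y. \<forall>b\<in>carrier K. x \<in> \<sigma> (h b) \<longleftrightarrow> y \<in> \<tau> b"
proof -
  note hD = bhilbert_homD(2-5)[OF h]
  obtain a where a: "a \<in> carrier K" "x \<in> \<sigma> (h a)"
    and least: "\<And>b. b \<in> carrier K \<Longrightarrow> x \<in> \<sigma> (h b) \<Longrightarrow> \<tau> a \<subseteq> \<tau> b"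
    using hom_least_preimage[OF h x] by blast
  have "\<tau> a \<noteq> {}"
  proof
    assume "\<tau> a = {}"
    then have "a = one K" using Y.rep_inject Y.rep_one a(1) Y.one_closed by simp
    then show False using a(2) hD(3) X.rep_one by simp
  qed
  then obtain y where y: "y \<in> min_elems (order Y) (\<tau> a)"
    using Y.min_below[of "\<tau> a"] Y.base_subset[OF Y.rep_base[OF a(1)]] by blast
  then have ya: "y \<in> \<tau> a" and yY: "y \<in> points Y"
    using Y.rep_points a(1) by (auto simp: min_elems_def)
  obtain b where b: "b \<in> carrier K" "\<tau> b = up_gen (order Y) {y}"
    using Y.rep_obtain Y.cone_base[OF yY] by blast
  have "x \<in> \<sigma> (h b)"
  proof (rule ccontr)
    assume "x \<notin> \<sigma> (h b)"
    then have "x \<in> \<sigma> (h (imp K b a))" using a b hD by (simp add: X.rep_impI)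
    then have "y \<in> \<tau> (imp K b a)" using least ya a b Y.imp_closed by blast
    then obtain w where w: "(w, y) \<in> order Y" "w \<in> \<tau> a" "w \<notin> \<tau> b"
      using a b by (auto simp: Y.mem_rep_imp)
    then have "w = y" using y by (auto simp: min_elems_def)
    then show False using w b(2) by (auto simp: up_gen_def)
  qed
  have "x \<in> \<sigma> (h c) \<longleftrightarrow> y \<in> \<tau> c" if c: "c \<in> carrier K" for c
  proof
    assume "x \<in> \<sigma> (h c)"
    then show "y \<in> \<tau> c" using least c ya by blast
  next
    assume "y \<in> \<tau> c"
    then have "\<tau> b \<subseteq> \<tau> c" using b(2) Y.rep_up[OF c] by (auto simp: up_gen_def)
    then have "imp K c b = one K" using Y.imp_eq_one_iff b c by blast
    then have "imp H (h c) (h b) = one H" using hD b c by metis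
    then show "x \<in> \<sigma> (h c)" using X.imp_eq_one_iff hD(1) b(1) c \<open>x \<in> \<sigma> (h b)\<close> by blast
  qed
  then show ?thesis using yY by blast
qed

text \<open>
  The points given by the preceding lemma define a map \<open>f\<close> that is monotone because the values of
  \<open>h\<close> are upsets.  For openness, given \<open>y \<le> f x\<close>, the required point \<open>z\<close> is a minimal element of
  \<open>h([y))\<close> below \<open>x\<close>: with \<open>\<tau> b = [y)\<close> and \<open>\<tau> c = [f z)\<close>, if \<open>f z \<noteq> y\<close> then \<open>c \<rightarrow> b\<close> is \<open>b\<close>, so that
  \<open>z \<in> h(c) \<rightarrow> h(b)\<close>, and a point of \<open>h(b) \<setminus> h(c)\<close> lies strictly below \<open>z\<close>, contrary to
  the minimality of \<open>z\<close>.
\<close>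

lemma hom_is_pullback:
  assumes h: "h \<in> bhilbert_hom K H"
  shows "h \<in> pullback X H \<sigma> K \<tau> ` hFor_hom X Y"
proof -
  note hD = bhilbert_homD(2-5)[OF h]
  obtain f0 where f0: "\<And>x. x \<in> points X \<Longrightarrow> f0 x \<in> points Y"
    "\<And>x b. x \<in> points X \<Longrightarrow> b \<in> carrier K \<Longrightarrow> x \<in> \<sigma> (h b) \<longleftrightarrow> f0 x \<in> \<tau> b"
    using hom_dual_point[OF h] by metis
  define f where "f = restrict f0 (points X)"
  have fY: "f x \<in> points Y" and f: "\<And>b. b \<in> carrier K \<Longrightarrow> x \<in> \<sigma> (h b) \<longleftrightarrow> f x \<in> \<tau> b"
    if "x \<in> points X" for x
    using f0 that unfolding f_def by auto
  have eq: "\<sigma> (h a) = f -` \<tau> a \<inter> points X" if "a \<in> carrier K" for a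
    using f that X.rep_points hD(1) by blast
  have cone: "\<exists>b\<in>carrier K. \<tau> b = up_gen (order Y) {y}" if "y \<in> points Y" for y
    using Y.rep_obtain Y.cone_base[OF that] by metis
  have "(f x, f x') \<in> order Y"
    if x: "x \<in> points X" "x' \<in> points X" "(x, x') \<in> order X" for x x'
  proof -
    obtain b where b: "b \<in> carrier K" "\<tau> b = up_gen (order Y) {f x}"
      using cone fY[OF x(1)] by blast
    then have "x \<in> \<sigma> (h b)" using f x(1) Y.order_refl[OF fY[OF x(1)]] by (auto simp: up_gen_def)
    then have "x' \<in> \<sigma> (h b)" using X.rep_up hD(1) b(1) x(3) by blast
    then show ?thesis using f[OF x(2) b(1)] b(2) by (auto simp: up_gen_def)
  qed
  moreover have "\<exists>z\<in>points X. (z, x) \<in> order X \<and> f z = y"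
    if x: "x \<in> points X" and y: "y \<in> points Y" "(y, f x) \<in> order Y" for x y
  proof -
    obtain b where b: "b \<in> carrier K" "\<tau> b = up_gen (order Y) {y}" using cone y(1) by blast
    have hb: "h b \<in> carrier H" using hD(1) b(1) .
    have "x \<in> \<sigma> (h b)" using f[OF x b(1)] b(2) y(2) by (auto simp: up_gen_def)
    then obtain z where z: "z \<in> min_elems (order X) (\<sigma> (h b))" "(z, x) \<in> order X"
      using X.min_below[OF X.base_subset[OF X.rep_base[OF hb]]] by blast
    have zb: "z \<in> \<sigma> (h b)" and zX: "z \<in> points X"
      using z X.rep_points[OF hb] by (auto simp: min_elems_def)
    have yfz: "(y, f z) \<in> order Y" using f[OF zX b(1)] zb b(2) by (auto simp: up_gen_def)
    obtain c where c: "c \<in> carrier K" "\<tau> c = up_gen (order Y) {f z}" using cone fY[OF zX] by blast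
    have zc: "z \<in> \<sigma> (h c)" using f[OF zX c(1)] c(2) Y.order_refl[OF fY[OF zX]] by (auto simp: up_gen_def)
    have "f z = y"
    proof (rule ccontr)
      assume "f z \<noteq> y"
      then have "y \<notin> \<tau> c" using c(2) yfz Y.order_antisym by (auto simp: up_gen_def)
      then have "\<tau> b \<subseteq> \<tau> (imp K c b)"
        using b c Y.order_refl[OF y(1)] by (auto simp: up_gen_def Y.mem_rep_imp)
      then have "f z \<in> \<tau> (imp K c b)" using f[OF zX b(1)] zb by blast
      then have "z \<in> \<sigma> (imp H (h c) (h b))"
        using f[OF zX] Y.imp_closed[OF c(1) b(1)] hD(2)[OF c(1) b(1)] by metis
      then obtain w where "(w, z) \<in> order X" "w \<in> \<sigma> (h b)" "w \<notin> \<sigma> (h c)"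
        using X.mem_rep_imp hD(1) b(1) c(1) by blast
      then show False using z(1) zc by (auto simp: min_elems_def)
    qed
    then show ?thesis using zX z(2) by blast
  qed
  moreover have "f -` U \<inter> points X \<in> base X" if "U \<in> base Y" for U
    using Y.rep_obtain[OF that] eq X.rep_base hD(1) by metis
  moreover have "f \<in> points X \<rightarrow>\<^sub>E points Y" using fY by (auto simp: f_def)
  ultimately have fh: "f \<in> hFor_hom X Y" unfolding hFor_hom_def by blast
  show ?thesis using pullback_eqI[OF fh h eq] fh by blast
qed

lemma bij_betw_pullback:
  "bij_betw (pullback X H \<sigma> K \<tau>) (hFor_hom X Y) (bhilbert_hom K H)"
proof -
  have "pullback X H \<sigma> K \<tau> ` hFor_hom X Y = bhilbert_hom K H"
    using pullback_hom hom_is_pullback by (intro subset_antisym subsetI) auto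
  then show ?thesis using inj_on_pullback unfolding bij_betw_def by blast
qed

end

section \<open>The dual functor\<close>

lemma id_bhilbert_hom:
  assumes "bounded_prelinear_hilbert_algebra H"
  shows "(\<lambda>a\<in>carrier H. a) \<in> bhilbert_hom H H"
proof -
  interpret bounded_prelinear_hilbert_algebra H by (rule assms)
  show ?thesis
    unfolding bhilbert_hom_def using one_closed zero_closed imp_closed by auto
qed

lemma compose_bhilbert_hom:
  assumes "bounded_prelinear_hilbert_algebra H"
    and f: "f \<in> bhilbert_hom H K" and g: "g \<in> bhilbert_hom K L"
  shows "compose (carrier H) g f \<in> bhilbert_hom H L"
proof -
  interpret bounded_prelinear_hilbert_algebra H by (rule assms)
  have "compose (carrier H) g f \<in> carrier H \<rightarrow>\<^sub>E carrier L"
    using bhilbert_homD(2)[OF f] bhilbert_homD(2)[OF g] by (auto simp: compose_def)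
  then show ?thesis
    unfolding bhilbert_hom_def using one_closed zero_closed imp_closed
    by (simp add: compose_eq bhilbert_homD[OF f] bhilbert_homD[OF g])
qed

lemma category_fPHil0: "category fPHil0"
proof
  fix A B D E :: "'b bhilbert" and f g h
  assume "f \<in> Hom fPHil0 A B" "g \<in> Hom fPHil0 B D" "h \<in> Hom fPHil0 D E"
  then show "Comp fPHil0 A D E h (Comp fPHil0 A B D g f) =
      Comp fPHil0 A B E (Comp fPHil0 B D E h g) f"
    using bhilbert_homD(1)[of f A B] by (auto simp: fPHil0_def PiE_def intro!: compose_assoc)
next
  fix A B D :: "'b bhilbert" and f g
  assume "A \<in> Obj fPHil0" "f \<in> Hom fPHil0 A B" "g \<in> Hom fPHil0 B D"
  then show "Comp fPHil0 A B D g f \<in> Hom fPHil0 A D"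
    by (simp add: fPHil0_def compose_bhilbert_hom)
qed (auto simp: fPHil0_def id_bhilbert_hom PiE_def
    dest!: bhilbert_homD(1) intro!: compose_Id Id_compose)

text \<open>
  The algebra of the h-base consists of sets of points of \<open>X\<close>, whereas the objects of \<open>fPHil0\<close> live
  in a fixed infinite type; an arbitrary injection of the finite h-base bridges the two.
\<close>

definition encode :: "'a based_forest \<Rightarrow> 'a set \<Rightarrow> 'b::infinite" where
  "encode X = (SOME e. inj_on e (base X))"

definition decode :: "'a based_forest \<Rightarrow> 'b::infinite \<Rightarrow> 'a set" where
  "decode X = inv_into (base X) (encode X)"

definition forest_algebra :: "'a based_forest \<Rightarrow> 'b::infinite bhilbert" where
  "forest_algebra X =
    \<lparr>carrier = encode X ` base X,
     imp = (\<lambda>a b. encode X (up_gen (order X) (decode X b - decode X a))),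
     one = encode X {},
     zero = encode X (points X)\<rparr>"

lemma representation_forest_algebra:
  fixes X :: "'a based_forest"
  assumes "X \<in> based_forests"
  shows "representation X (forest_algebra X :: 'b::infinite bhilbert) (decode X)"
proof -
  interpret forest X using assms by unfold_locales
  have inj: "inj_on (encode X :: 'a set \<Rightarrow> 'b) (base X)"
    unfolding encode_def using arb_inj_on_finite_infinite[OF finite_base] by (rule someI_ex)
  then have dec: "decode X (encode X U :: 'b) = U" if "U \<in> base X" for U
    using that by (simp add: decode_def)
  show ?thesis
    using dec diff_base empty_base points_base
    by unfold_locales
      (auto simp: forest_algebra_def decode_def bij_betw_inv_into[OF inj_on_imp_bij_betw[OF inj]])
qed

text \<open>
  In the opposite of \<open>hFor\<close>, a morphism from \<open>Y\<close> to \<open>X\<close> is an open map \<open>X \<rightarrow> Y\<close>; it is sent to its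
  inverse image map.
\<close>

definition dual_functor ::
  "('a based_forest, 'a \<Rightarrow> 'a, 'b::infinite bhilbert, 'b \<Rightarrow> 'b) functor_data" where
  "dual_functor = \<lparr>fobj = forest_algebra,
    fmor = (\<lambda>Y X. pullback X (forest_algebra X) (decode X) (forest_algebra Y) (decode Y))\<rparr>"

lemma representation_pairI:
  "\<lbrakk>representation X H \<sigma>; representation Y K \<tau>\<rbrakk> \<Longrightarrow> representation_pair X H \<sigma> Y K \<tau>"
  by (simp add: representation_pair_def)

lemma pullback_id:
  assumes "representation X H \<sigma>"
  shows "pullback X H \<sigma> H \<sigma> (\<lambda>x\<in>points X. x) = (\<lambda>a\<in>carrier H. a)"
proof -
  interpret representation_pair X H \<sigma> X H \<sigma>
    using assms by (intro representation_pairI)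
  have "bounded_prelinear_hilbert_algebra H"
    using X.represented_in_fPHil0 by (simp add: fPHil0_def)
  then show ?thesis
    using X.rep_points
    by (intro pullback_eqI[symmetric] id_hFor_hom id_bhilbert_hom X.forest) auto
qed

lemma pullback_compose:
  fixes X Y Z :: "'a based_forest" and H K L :: "'b bhilbert"
  assumes "representation X H \<sigma>" "representation Y K \<tau>" "representation Z L \<rho>"
    and f: "f \<in> hFor_hom X Y" and g: "g \<in> hFor_hom Y Z"
  shows "pullback X H \<sigma> L \<rho> (compose (points X) g f) =
    compose (carrier L) (pullback X H \<sigma> K \<tau> f) (pullback Y K \<tau> L \<rho> g)"
proof -
  interpret XY: representation_pair X H \<sigma> Y K \<tau> using assms by (intro representation_pairI)
  interpret YZ: representation_pair Y K \<tau> Z L \<rho> using assms by (intro representation_pairI)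
  interpret XZ: representation_pair X H \<sigma> Z L \<rho> using assms by (intro representation_pairI)
  have "bounded_prelinear_hilbert_algebra L"
    using YZ.Y.represented_in_fPHil0 by (simp add: fPHil0_def)
  moreover have "\<sigma> (compose (carrier L) (pullback X H \<sigma> K \<tau> f) (pullback Y K \<tau> L \<rho> g) a) =
      compose (points X) g f -` \<rho> a \<inter> points X" if "a \<in> carrier L" for a
    using that hFor_homD(2)[OF f]
    by (auto simp: compose_eq XY.rep_pullback[OF f] YZ.rep_pullback[OF g])
  ultimately show ?thesis
    using f g XY.pullback_hom YZ.pullback_hom
    by (intro XZ.pullback_eqI[symmetric] compose_hFor_hom compose_bhilbert_hom)
qed

lemma cat_functor_dual_functor:
  "cat_functor (op_category hFor) fPHil0
    (dual_functor :: ('a based_forest, 'a \<Rightarrow> 'a, 'b::infinite bhilbert, 'b \<Rightarrow> 'b) functor_data)"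
proof -
  note rep = representation_forest_algebra
  have pair: "representation_pair X (forest_algebra X :: 'b bhilbert) (decode X)
      Y (forest_algebra Y :: 'b bhilbert) (decode Y)"
    if "X \<in> based_forests" "Y \<in> based_forests" for X Y :: "'a based_forest"
    using that by (intro representation_pairI rep)
  interpret C: category "op_category (hFor :: ('a based_forest, 'a \<Rightarrow> 'a) category_data)"
    by (intro category_op category_hFor)
  interpret D: category "fPHil0 :: ('b bhilbert, 'b \<Rightarrow> 'b) category_data"
    by (rule category_fPHil0)
  note defs = op_category_def hFor_def dual_functor_def
  show ?thesis
    by unfold_locales
      (simp_all add: defs representation.represented_in_fPHil0[OF rep]
        representation_pair.pullback_hom[OF pair] pullback_id[OF rep]
        pullback_compose[OF rep rep rep] fPHil0_def
        representation.represented_in_fPHil0[OF rep, unfolded fPHil0_def, simplified])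
qed

lemma representations_isomorphic:
  fixes X :: "'a based_forest" and H K :: "'b bhilbert"
  assumes "representation X H \<sigma>" "representation X K \<tau>"
  shows "iso_in fPHil0 H K (pullback X K \<tau> H \<sigma> (\<lambda>x\<in>points X. x))"
proof -
  interpret HK: representation_pair X H \<sigma> X K \<tau> using assms by (intro representation_pairI)
  interpret KH: representation_pair X K \<tau> X H \<sigma> using assms by (intro representation_pairI)
  let ?i = "\<lambda>x\<in>points X. x"
  have i: "?i \<in> hFor_hom X X" by (intro id_hFor_hom HK.X.forest)
  have ii: "compose (points X) ?i ?i = ?i" by (auto simp: compose_def)
  have "compose (carrier H) (pullback X H \<sigma> K \<tau> ?i) (pullback X K \<tau> H \<sigma> ?i) = (\<lambda>a\<in>carrier H. a)"
    using pullback_compose[OF assms(1,2,1) i i] pullback_id[OF assms(1)] by (simp add: ii)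
  moreover have "compose (carrier K) (pullback X K \<tau> H \<sigma> ?i) (pullback X H \<sigma> K \<tau> ?i) =
      (\<lambda>a\<in>carrier K. a)"
    using pullback_compose[OF assms(2,1,2) i i] pullback_id[OF assms(2)] by (simp add: ii)
  ultimately show ?thesis
    unfolding iso_in_def fPHil0_def using HK.pullback_hom[OF i] KH.pullback_hom[OF i] by auto
qed

section \<open>Irreducible elements of Hilbert algebras\<close>

context hilbert_algebra
begin

abbreviation arrow (infixr "\<leadsto>" 60) where "a \<leadsto> b \<equiv> imp H a b"
abbreviation top_elem ("\<one>") where "\<one> \<equiv> one H"

text \<open>
  Modus ponens in the form used below is extracted from antisymmetry.  The axiom
  \<open>a \<rightarrow> (b \<rightarrow> a) = 1\<close> shows that \<open>a \<rightarrow> 1 = 1\<close> whenever \<open>c \<rightarrow> a = 1\<close> for some \<open>c\<close>.  This applies to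
  \<open>a \<rightarrow> 1\<close> with \<open>c = 1\<close>, so \<open>a \<rightarrow> 1\<close> and \<open>1\<close> are below each other.
\<close>

lemma imp_one: "a \<in> carrier H \<Longrightarrow> a \<leadsto> \<one> = \<one>"
proof -
  have ab: "a \<leadsto> \<one> = \<one>" if "a \<in> carrier H" "c \<in> carrier H" "c \<leadsto> a = \<one>" for a c
    using imp_K[OF that(1,2)] that(3) by simp
  assume a: "a \<in> carrier H"
  have "\<one> \<leadsto> (a \<leadsto> \<one>) = \<one>" using imp_K a one_closed imp_closed by blast
  then show "a \<leadsto> \<one> = \<one>" using ab imp_antisym a one_closed imp_closed by metis
qed

lemma one_imp_eq_oneD: "\<lbrakk>\<one> \<leadsto> a = \<one>; a \<in> carrier H\<rbrakk> \<Longrightarrow> a = \<one>"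
  using imp_antisym imp_one one_closed imp_closed by metis

lemma one_imp: "a \<in> carrier H \<Longrightarrow> \<one> \<leadsto> a = a"
proof -
  assume a: "a \<in> carrier H"
  let ?t = "\<one> \<leadsto> a"
  have t: "?t \<in> carrier H" using a one_closed imp_closed by simp
  have "(?t \<leadsto> ?t) \<leadsto> ((?t \<leadsto> \<one>) \<leadsto> (?t \<leadsto> a)) = \<one>" using imp_S[OF t one_closed a] .
  moreover have "?t \<leadsto> ?t = \<one>"
  proof -
    have "(?t \<leadsto> ((\<one> \<leadsto> ?t) \<leadsto> ?t)) \<leadsto> ((?t \<leadsto> (\<one> \<leadsto> ?t)) \<leadsto> (?t \<leadsto> ?t)) = \<one>"
      using imp_S[of ?t "\<one> \<leadsto> ?t" ?t] t one_closed imp_closed by simp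
    then show ?thesis using imp_K t one_closed imp_closed by (metis one_imp_eq_oneD)
  qed
  ultimately have "?t \<leadsto> a = \<one>" using imp_one a t one_closed imp_closed by (metis one_imp_eq_oneD)
  moreover have "a \<leadsto> ?t = \<one>" using imp_K a one_closed imp_closed by simp
  ultimately show "?t = a" using imp_antisym a t by blast
qed

lemma imp_self: "a \<in> carrier H \<Longrightarrow> a \<leadsto> a = \<one>"
  using imp_S[of a "\<one> \<leadsto> a" a] imp_K[of a] one_closed imp_closed by (metis one_imp)

lemma imp_mono:
  assumes "a \<in> carrier H" "b \<in> carrier H" "c \<in> carrier H" "b \<leadsto> c = \<one>"
  shows "(a \<leadsto> b) \<leadsto> (a \<leadsto> c) = \<one>"
  using imp_S[OF assms(1-3)] assms by (simp add: imp_one one_imp one_closed imp_closed)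

lemma imp_trans:
  assumes "a \<in> carrier H" "b \<in> carrier H" "c \<in> carrier H" "a \<leadsto> b = \<one>" "b \<leadsto> c = \<one>"
  shows "a \<leadsto> c = \<one>"
  using imp_mono[OF assms(1,2,3,5)] assms by (simp add: one_imp one_closed imp_closed)

lemma imp_antimono:
  assumes "a \<in> carrier H" "b \<in> carrier H" "c \<in> carrier H" "a \<leadsto> b = \<one>"
  shows "(b \<leadsto> c) \<leadsto> (a \<leadsto> c) = \<one>"
proof -
  have "(a \<leadsto> (b \<leadsto> c)) \<leadsto> (a \<leadsto> c) = \<one>"
    using imp_S[OF assms(1-3)] assms by (simp add: one_imp one_closed imp_closed)
  moreover have "(b \<leadsto> c) \<leadsto> (a \<leadsto> (b \<leadsto> c)) = \<one>" using imp_K assms one_closed imp_closed by simp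
  ultimately show ?thesis
    using imp_trans[of "b \<leadsto> c" "a \<leadsto> (b \<leadsto> c)" "a \<leadsto> c"] assms one_closed imp_closed by simp
qed

lemma imp_exchange:
  assumes "a \<in> carrier H" "b \<in> carrier H" "c \<in> carrier H"
  shows "a \<leadsto> (b \<leadsto> c) = b \<leadsto> (a \<leadsto> c)"
proof -
  have "(a \<leadsto> (b \<leadsto> c)) \<leadsto> (b \<leadsto> (a \<leadsto> c)) = \<one>"
    if "a \<in> carrier H" "b \<in> carrier H" "c \<in> carrier H" for a b c
  proof (rule imp_trans)
    show "(a \<leadsto> (b \<leadsto> c)) \<leadsto> ((a \<leadsto> b) \<leadsto> (a \<leadsto> c)) = \<one>" using imp_S that .
    show "((a \<leadsto> b) \<leadsto> (a \<leadsto> c)) \<leadsto> (b \<leadsto> (a \<leadsto> c)) = \<one>"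
      using that one_closed imp_closed imp_K by (intro imp_antimono) auto
  qed (use that one_closed imp_closed in auto)
  then show ?thesis using imp_antisym assms one_closed imp_closed by simp
qed

lemma imp_contract:
  assumes "a \<in> carrier H" "b \<in> carrier H"
  shows "a \<leadsto> (a \<leadsto> b) = a \<leadsto> b"
proof (rule imp_antisym)
  show "(a \<leadsto> (a \<leadsto> b)) \<leadsto> (a \<leadsto> b) = \<one>"
    using imp_S[OF assms(1) assms] assms by (simp add: imp_self one_imp one_closed imp_closed)
  show "(a \<leadsto> b) \<leadsto> (a \<leadsto> (a \<leadsto> b)) = \<one>" using imp_K assms one_closed imp_closed by simp
qed (use assms one_closed imp_closed in auto)

lemma le_double_imp: "\<lbrakk>a \<in> carrier H; b \<in> carrier H\<rbrakk> \<Longrightarrow> a \<leadsto> ((a \<leadsto> b) \<leadsto> b) = \<one>"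
  using imp_exchange[of a "a \<leadsto> b" b] imp_self[of "a \<leadsto> b"] one_closed imp_closed by simp

text \<open>
  In the algebra of an h-base these are exactly the cones \<open>[x)\<close>, which is why they serve as the
  points of the dual forest.
\<close>

definition irreducibles :: "'a set" where
  "irreducibles = {p \<in> carrier H. p \<noteq> \<one> \<and> (\<forall>a\<in>carrier H. a \<leadsto> p = p \<or> a \<leadsto> p = \<one>)}"

lemma finite_max_above:
  assumes "finite (carrier H)" "S \<subseteq> carrier H" "b \<in> S"
  shows "\<exists>c\<in>S. b \<leadsto> c = \<one> \<and> (\<forall>d\<in>S. c \<leadsto> d = \<one> \<longrightarrow> d = c)"
proof -
  let ?r = "{(a, b). a \<in> carrier H \<and> b \<in> carrier H \<and> b \<leadsto> a = \<one>}"
  have "finite S" using assms finite_subset by blast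
  moreover have "trans ?r" using imp_trans by (auto intro!: transI)
  moreover have "antisym ?r" using imp_antisym by (auto intro!: antisymI)
  moreover have "(b, b) \<in> ?r" using assms imp_self by auto
  ultimately obtain c where "c \<in> min_elems ?r S" "(c, b) \<in> ?r"
    using finite_min_below[OF _ _ _ assms(3)] by blast
  then show ?thesis using assms(2) by (intro bexI[of _ c]) (auto simp: min_elems_def)
qed

text \<open>
  An element \<open>p\<close> maximal among those above \<open>b\<close> but not above \<open>a\<close> satisfies \<open>a \<rightarrow> p = p\<close>, and is
  irreducible: as \<open>a \<rightarrow> (d \<rightarrow> p) = d \<rightarrow> (a \<rightarrow> p) = d \<rightarrow> p\<close>, the element \<open>d \<rightarrow> p\<close> is \<open>1\<close> or again one of
  the candidates, and then equal to \<open>p\<close>.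
\<close>

lemma irreducible_separation:
  assumes fin: "finite (carrier H)" and a: "a \<in> carrier H" and b: "b \<in> carrier H"
    and nle: "a \<leadsto> b \<noteq> \<one>"
  shows "\<exists>p\<in>irreducibles. b \<leadsto> p = \<one> \<and> a \<leadsto> p \<noteq> \<one>"
proof -
  let ?S = "{c \<in> carrier H. b \<leadsto> c = \<one> \<and> a \<leadsto> c \<noteq> \<one>}"
  obtain p where p: "p \<in> carrier H" "b \<leadsto> p = \<one>" "a \<leadsto> p \<noteq> \<one>"
    and maximal: "\<And>d. \<lbrakk>d \<in> ?S; p \<leadsto> d = \<one>\<rbrakk> \<Longrightarrow> d = p"
    using finite_max_above[OF fin, of ?S b] b nle imp_self[OF b] by auto
  have ap: "a \<leadsto> p = p"
    using a b p one_closed imp_closed imp_K imp_trans[OF b p(1) imp_closed[OF a p(1)]]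
    by (intro maximal) (auto simp: imp_contract)
  have "d \<leadsto> p = p \<or> d \<leadsto> p = \<one>" if d: "d \<in> carrier H" for d
  proof (rule disjCI)
    assume "d \<leadsto> p \<noteq> \<one>"
    then have "a \<leadsto> (d \<leadsto> p) \<noteq> \<one>"
      using imp_exchange[OF a d p(1)] ap by simp
    then show "d \<leadsto> p = p"
      using d b p one_closed imp_closed imp_K imp_trans[OF b p(1) imp_closed[OF d p(1)]]
      by (intro maximal) auto
  qed
  then have "p \<in> irreducibles"
    using p a imp_one unfolding irreducibles_def by auto
  then show ?thesis using p by blast
qed

text \<open>
  The forcing clause of implication, with irreducible elements as worlds.  For the forward
  direction, let \<open>c\<close> be maximal among the elements above \<open>b\<close>, not above \<open>a\<close>, with \<open>a \<rightarrow> c \<le> q\<close>; the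
  element \<open>b\<close> itself is a candidate.  Then \<open>a \<rightarrow> c = c\<close> by maximality, whence \<open>c \<le> q\<close>.  If
  \<open>d \<rightarrow> c \<noteq> 1\<close>, then \<open>d \<rightarrow> c\<close> is again a candidate, hence equal to \<open>c\<close>; the only point to check is
  \<open>d \<rightarrow> c \<le> q\<close>.
\<close>

lemma irreducible_above_imp:
  assumes fin: "finite (carrier H)" and a: "a \<in> carrier H" and b: "b \<in> carrier H"
    and q: "q \<in> irreducibles"
  shows "(a \<leadsto> b) \<leadsto> q = \<one> \<longleftrightarrow> (\<exists>r\<in>irreducibles. r \<leadsto> q = \<one> \<and> b \<leadsto> r = \<one> \<and> a \<leadsto> r \<noteq> \<one>)"
proof
  assume "\<exists>r\<in>irreducibles. r \<leadsto> q = \<one> \<and> b \<leadsto> r = \<one> \<and> a \<leadsto> r \<noteq> \<one>"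
  then obtain r where r: "r \<in> irreducibles" "r \<leadsto> q = \<one>" "b \<leadsto> r = \<one>" "a \<leadsto> r \<noteq> \<one>" by blast
  then have "a \<leadsto> r = r" and rH: "r \<in> carrier H" using a unfolding irreducibles_def by auto
  then have "(a \<leadsto> b) \<leadsto> r = \<one>" using imp_mono[OF a b rH r(3)] by simp
  then show "(a \<leadsto> b) \<leadsto> q = \<one>"
    using imp_trans[OF imp_closed[OF a b] rH _ _ r(2)] q unfolding irreducibles_def by simp
next
  assume le: "(a \<leadsto> b) \<leadsto> q = \<one>"
  have qH: "q \<in> carrier H" and q1: "q \<noteq> \<one>"
    and qi: "\<And>d. d \<in> carrier H \<Longrightarrow> d \<leadsto> q = q \<or> d \<leadsto> q = \<one>"
    using q unfolding irreducibles_def by auto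
  let ?S = "{c \<in> carrier H. b \<leadsto> c = \<one> \<and> a \<leadsto> c \<noteq> \<one> \<and> (a \<leadsto> c) \<leadsto> q = \<one>}"
  have "a \<leadsto> b \<noteq> \<one>" using le q1 qH one_imp by auto
  then have "b \<in> ?S" using le b imp_self by blast
  then obtain c where c: "c \<in> carrier H" "b \<leadsto> c = \<one>" "a \<leadsto> c \<noteq> \<one>" "(a \<leadsto> c) \<leadsto> q = \<one>"
    and maximal: "\<And>d. \<lbrakk>d \<in> ?S; c \<leadsto> d = \<one>\<rbrakk> \<Longrightarrow> d = c"
    using finite_max_above[OF fin, of ?S b] by auto
  have above: "b \<leadsto> d = \<one>" if "c \<leadsto> d = \<one>" "d \<in> carrier H" for d
    using imp_trans[OF b c(1) that(2) c(2) that(1)] .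
  have ac: "a \<leadsto> c = c"
    using a c imp_K[OF c(1) a] above imp_closed by (intro maximal) (auto simp: imp_contract)
  have "d \<leadsto> c = c \<or> d \<leadsto> c = \<one>" if d: "d \<in> carrier H" for d
  proof (rule disjCI)
    assume dc1: "d \<leadsto> c \<noteq> \<one>"
    have dc: "d \<leadsto> c \<in> carrier H" using d c one_closed imp_closed by simp
    have adc: "a \<leadsto> (d \<leadsto> c) = d \<leadsto> c"
      using imp_exchange[OF a d c(1)] ac by simp
    have "(d \<leadsto> c) \<leadsto> q = \<one>"
    proof (rule ccontr)
      assume "(d \<leadsto> c) \<leadsto> q \<noteq> \<one>"
      \<comment> \<open>Otherwise \<open>(d \<rightarrow> c) \<rightarrow> c\<close> is a candidate above \<open>c\<close>, hence \<open>c\<close> itself; but it is above \<open>d\<close>.\<close>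
      then have dcq: "(d \<leadsto> c) \<leadsto> q = q" using qi[OF dc] by simp
      let ?e = "(d \<leadsto> c) \<leadsto> c"
      have e: "?e \<in> carrier H" using dc c one_closed imp_closed by simp
      have "?e \<leadsto> q = \<one>" using imp_mono[OF dc c(1) qH] c(4) ac dcq by simp
      moreover have "a \<leadsto> ?e = ?e" using imp_exchange[OF a dc c(1)] ac by simp
      moreover have "?e \<noteq> \<one>" using \<open>?e \<leadsto> q = \<one>\<close> q1 qH one_imp by auto
      moreover have "c \<leadsto> ?e = \<one>" using imp_K c(1) dc by simp
      ultimately have "?e = c" using e above by (intro maximal) auto
      then show False using le_double_imp[OF d c(1)] dc1 by simp
    qed
    then show "d \<leadsto> c = c"
      using dc dc1 adc above imp_K[OF c(1) d] by (intro maximal) auto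
  qed
  then have "c \<in> irreducibles" using c a imp_one unfolding irreducibles_def by auto
  then show "\<exists>r\<in>irreducibles. r \<leadsto> q = \<one> \<and> b \<leadsto> r = \<one> \<and> a \<leadsto> r \<noteq> \<one>"
    using c ac by auto
qed

end

section \<open>Representation of finite bounded prelinear Hilbert algebras\<close>

lemma hilbert_chain_prelinear:
  assumes "hilbert_chain C" and abc: "a \<in> carrier C" "b \<in> carrier C" "c \<in> carrier C"
  shows "imp C (imp C (imp C a b) c) (imp C (imp C (imp C b a) c) c) = one C"
proof -
  interpret hilbert_algebra C using assms by (simp add: hilbert_chain_def)
  have "imp C a b = one C \<or> imp C b a = one C"
    using assms unfolding hilbert_chain_def nat_le_def by blast
  then show ?thesis
    using abc by (auto simp: one_imp imp_self imp_one imp_K one_closed imp_closed)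
qed

text \<open>
  Membership in the variety enters the duality through this identity, which holds in chains because
  one of \<open>a \<rightarrow> b\<close>, \<open>b \<rightarrow> a\<close> is \<open>1\<close> there.
\<close>

lemma (in prelinear_hilbert_algebra) prelinear:
  assumes "a \<in> carrier H" "b \<in> carrier H" "c \<in> carrier H"
  shows "((a \<leadsto> b) \<leadsto> c) \<leadsto> (((b \<leadsto> a) \<leadsto> c) \<leadsto> c) = \<one>"
proof -
  let ?x = "Var 0" and ?y = "Var 1" and ?z = "Var 2"
  let ?E = "{(Imp (Imp (Imp ?x ?y) ?z) (Imp (Imp (Imp ?y ?x) ?z) ?z), One)}"
  have "models_identities C ?E" if "hilbert_chain C" for C :: "'a hilbert"
    using hilbert_chain_prelinear[OF that] by (auto simp: models_identities_def range_subsetD)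
  then have "models_identities H ?E"
    using in_variety unfolding in_variety_of_chains_def by blast
  moreover have "range ((\<lambda>_. c)(0 := a, 1 := b)) \<subseteq> carrier H"
    using assms by auto
  ultimately have "imp_term_val H ((\<lambda>_. c)(0 := a, 1 := b)) s = imp_term_val H ((\<lambda>_. c)(0 := a, 1 := b)) t"
    if "(s, t) \<in> ?E" for s t
    using that unfolding models_identities_def by blast
  then show ?thesis by simp
qed

text \<open>
  If \<open>q\<close> and \<open>r\<close> are incomparable, irreducibility gives \<open>q \<rightarrow> r = r\<close> and \<open>r \<rightarrow> q = q\<close>, and the
  prelinearity identity for \<open>q, r, p\<close> collapses to \<open>p = 1\<close>.
\<close>

lemma (in prelinear_hilbert_algebra) irreducibles_below_comparable:
  assumes p: "p \<in> irreducibles" and q: "q \<in> irreducibles" "q \<leadsto> p = \<one>"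
    and r: "r \<in> irreducibles" "r \<leadsto> p = \<one>"
  shows "q \<leadsto> r = \<one> \<or> r \<leadsto> q = \<one>"
proof (rule ccontr)
  assume "\<not> (q \<leadsto> r = \<one> \<or> r \<leadsto> q = \<one>)"
  then have "q \<leadsto> r = r" "r \<leadsto> q = q" and H: "p \<in> carrier H" "q \<in> carrier H" "r \<in> carrier H"
    and "p \<noteq> \<one>"
    using p q r unfolding irreducibles_def by blast+
  then show False
    using prelinear[OF H(2,3,1)] q(2) r(2) by (simp add: one_imp)
qed

text \<open>
  The points are the irreducible elements, carried by \<open>e\<close> into the type of points of the forests.
  An element \<open>a\<close> is represented by the irreducibles above it; the h-base consists of these sets.
\<close>

lemma representation_on_irreducibles:
  fixes H :: "'b bhilbert" and e :: "'b \<Rightarrow> 'a"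
  assumes "bounded_prelinear_hilbert_algebra H" and fin: "finite (carrier H)"
    and e: "inj_on e (hilbert_algebra.irreducibles H)"
  shows "\<exists>(X :: 'a based_forest) \<sigma>. representation X H \<sigma>"
proof -
  interpret bounded_prelinear_hilbert_algebra H by (rule assms)
  let ?J = irreducibles
  have J: "p \<in> carrier H" "p \<noteq> \<one>" if "p \<in> ?J" for p
    using that unfolding irreducibles_def by auto
  define \<sigma> where "\<sigma> = (\<lambda>a. e ` {p \<in> ?J. a \<leadsto> p = \<one>})"
  define r where "r = {(e p, e q) |p q. p \<in> ?J \<and> q \<in> ?J \<and> p \<leadsto> q = \<one>}"
  define X where "X = \<lparr>points = e ` ?J, order = r, base = \<sigma> ` carrier H\<rparr>"
  have e_eq: "e p = e q \<longleftrightarrow> p = q" if "p \<in> ?J" "q \<in> ?J" for p q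
    using inj_on_eq_iff[OF e that] .
  have mem_\<sigma>: "e p \<in> \<sigma> a \<longleftrightarrow> a \<leadsto> p = \<one>" if "p \<in> ?J" for p a
    using that e_eq unfolding \<sigma>_def by auto
  have mem_r: "(e p, e q) \<in> r \<longleftrightarrow> p \<leadsto> q = \<one>" if "p \<in> ?J" "q \<in> ?J" for p q
    using that e_eq unfolding r_def by auto
  have \<sigma>_sub: "\<sigma> a \<subseteq> e ` ?J" for a unfolding \<sigma>_def by auto
  have r_sub: "r \<subseteq> e ` ?J \<times> e ` ?J" unfolding r_def by auto
  have \<sigma>_imp: "\<sigma> (a \<leadsto> b) = up_gen r (\<sigma> b - \<sigma> a)" if ab: "a \<in> carrier H" "b \<in> carrier H" for a b
  proof -
    have "e q \<in> \<sigma> (a \<leadsto> b) \<longleftrightarrow> e q \<in> up_gen r (\<sigma> b - \<sigma> a)" if q: "q \<in> ?J" for q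
    proof -
      have "e q \<in> up_gen r (\<sigma> b - \<sigma> a) \<longleftrightarrow>
          (\<exists>p\<in>?J. p \<leadsto> q = \<one> \<and> b \<leadsto> p = \<one> \<and> a \<leadsto> p \<noteq> \<one>)"
      proof
        assume "e q \<in> up_gen r (\<sigma> b - \<sigma> a)"
        then obtain y where y: "y \<in> \<sigma> b" "y \<notin> \<sigma> a" "(y, e q) \<in> r" by (auto simp: up_gen_def)
        then obtain p where "p \<in> ?J" "y = e p" using \<sigma>_sub by blast
        then show "\<exists>p\<in>?J. p \<leadsto> q = \<one> \<and> b \<leadsto> p = \<one> \<and> a \<leadsto> p \<noteq> \<one>"
          using y q mem_\<sigma> mem_r by auto
      next
        assume "\<exists>p\<in>?J. p \<leadsto> q = \<one> \<and> b \<leadsto> p = \<one> \<and> a \<leadsto> p \<noteq> \<one>"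
        then obtain p where "p \<in> ?J" "p \<leadsto> q = \<one>" "b \<leadsto> p = \<one>" "a \<leadsto> p \<noteq> \<one>" by blast
        then have "e p \<in> \<sigma> b - \<sigma> a" "(e p, e q) \<in> r" using q mem_\<sigma> mem_r by auto
        then show "e q \<in> up_gen r (\<sigma> b - \<sigma> a)" unfolding up_gen_def by blast
      qed
      then show ?thesis
        using irreducible_above_imp[OF fin ab q] mem_\<sigma>[OF q] by simp
    qed
    moreover have "up_gen r (\<sigma> b - \<sigma> a) \<subseteq> e ` ?J" using r_sub by (auto simp: up_gen_def)
    ultimately show ?thesis using \<sigma>_sub[of "a \<leadsto> b"] by blast
  qed
  have cone: "up_gen r {e p} = \<sigma> p" if p: "p \<in> ?J" for p
  proof -
    have "e q \<in> up_gen r {e p} \<longleftrightarrow> e q \<in> \<sigma> p" if "q \<in> ?J" for q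
      using that p mem_\<sigma> mem_r by (simp add: up_gen_def)
    moreover have "up_gen r {e p} \<subseteq> e ` ?J" using r_sub by (auto simp: up_gen_def)
    ultimately show ?thesis using \<sigma>_sub[of p] by blast
  qed
  have up: "upset (e ` ?J) r (\<sigma> a)" if a: "a \<in> carrier H" for a
    unfolding upset_def
  proof (intro conjI ballI allI impI \<sigma>_sub)
    fix x y assume xy: "x \<in> \<sigma> a" "(x, y) \<in> r"
    then obtain p q where "x = e p" "y = e q" "p \<in> ?J" "q \<in> ?J" unfolding r_def by auto
    then show "y \<in> \<sigma> a" using xy mem_\<sigma> mem_r a J imp_trans[of a p q] by simp
  qed
  have po: "partial_order_on (e ` ?J) r"
    unfolding partial_order_on_def preorder_on_def
  proof (intro conjI r_sub)
    show "refl_on (e ` ?J) r" using mem_r J imp_self by (auto intro!: refl_onI)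
    show "trans r"
    proof (rule transI)
      fix x y z assume xyz: "(x, y) \<in> r" "(y, z) \<in> r"
      then obtain p q s where "x = e p" "y = e q" "z = e s" "p \<in> ?J" "q \<in> ?J" "s \<in> ?J"
        using r_sub by blast
      then show "(x, z) \<in> r" using xyz mem_r J imp_trans[of p q s] by simp
    qed
    show "antisym r"
    proof (rule antisymI)
      fix x y assume xy: "(x, y) \<in> r" "(y, x) \<in> r"
      then obtain p q where "x = e p" "y = e q" "p \<in> ?J" "q \<in> ?J" using r_sub by blast
      then show "x = y" using xy mem_r J imp_antisym[of p q] by simp
    qed
  qed
  have finJ: "finite (e ` ?J)" using fin J by (meson finite_imageI finite_subset subsetI)
  have "under r x \<in> Chains r" if "x \<in> e ` ?J" for x
  proof -
    have "(y, z) \<in> r \<or> (z, y) \<in> r" if yz: "(y, x) \<in> r" "(z, x) \<in> r" for y z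
    proof -
      obtain p q s where "x = e p" "y = e q" "z = e s" "p \<in> ?J" "q \<in> ?J" "s \<in> ?J"
        using yz r_sub by blast
      then show ?thesis using yz mem_r irreducibles_below_comparable[of p q s] by simp
    qed
    then show ?thesis unfolding Chains_def under_def by blast
  qed
  moreover have "h_base (e ` ?J) r (\<sigma> ` carrier H)"
  proof (rule h_base_if_closed_under_diff[OF po _ _ _ finJ])
    fix A B assume "A \<in> \<sigma> ` carrier H" "B \<in> \<sigma> ` carrier H"
    then obtain a b where ab: "a \<in> carrier H" "b \<in> carrier H" "A = \<sigma> a" "B = \<sigma> b" by blast
    then show "up_gen r (B - A) \<in> \<sigma> ` carrier H"
      using \<sigma>_imp[OF ab(1,2)] imp_closed[OF ab(1,2)] by (metis imageI)
  next
    fix x assume "x \<in> e ` ?J"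
    then show "up_gen r {x} \<in> \<sigma> ` carrier H" using cone J(1) by blast
  next
    fix B assume "B \<in> \<sigma> ` carrier H"
    then show "upset (e ` ?J) r B" using up by blast
  qed
  moreover have zero: "\<sigma> (zero H) = e ` ?J"
    using zero_le J unfolding \<sigma>_def nat_le_def by auto
  ultimately have X: "X \<in> based_forests"
    unfolding based_forests_def finite_forest_def X_def
    using finJ po imageI[OF zero_closed, of \<sigma>] by simp
  have "inj_on \<sigma> (carrier H)"
  proof (rule inj_onI)
    have le: "b \<leadsto> a = \<one>" if ab: "a \<in> carrier H" "b \<in> carrier H" "\<sigma> a = \<sigma> b" for a b
    proof (rule ccontr)
      assume "b \<leadsto> a \<noteq> \<one>"
      then obtain p where "p \<in> ?J" "a \<leadsto> p = \<one>" "b \<leadsto> p \<noteq> \<one>"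
        using irreducible_separation[OF fin ab(2,1)] by blast
      then show False using mem_\<sigma> ab(3) by metis
    qed
    fix a b assume "a \<in> carrier H" "b \<in> carrier H" "\<sigma> a = \<sigma> b"
    then show "a = b" using le imp_antisym by metis
  qed
  then have "bij_betw \<sigma> (carrier H) (base X)"
    by (simp add: X_def bij_betw_def)
  moreover have "\<sigma> \<one> = {}" using J one_imp unfolding \<sigma>_def by auto
  ultimately have "representation X H \<sigma>"
    using X zero \<sigma>_imp zero_closed
    by unfold_locales (simp_all add: X_def)
  then show ?thesis by blast
qed

text \<open>
  Essential surjectivity holds since \<open>H\<close> and the algebra of its forest of irreducibles are
  represented on the same forest, and two algebras represented on one forest are isomorphic.
\<close>

theorem hFor_dually_equivalent_fPHil0:
  "dually_equivalent_categories
    (hFor :: ('a::infinite based_forest, 'a \<Rightarrow> 'a) category_data)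
    (fPHil0 :: ('b::infinite bhilbert, 'b \<Rightarrow> 'b) category_data)"
  unfolding dually_equivalent_categories_def
proof (rule fully_faithful_essentially_surjective_imp_equivalent[OF cat_functor_dual_functor])
  fix X Y :: "'a based_forest"
  assume "X \<in> Obj (op_category hFor)" "Y \<in> Obj (op_category hFor)"
  then show "bij_betw (fmor dual_functor X Y) (Hom (op_category hFor) X Y)
      (Hom fPHil0 (fobj dual_functor X) (fobj dual_functor Y :: 'b bhilbert))"
    using representation_pair.bij_betw_pullback[OF representation_pairI[OF
          representation_forest_algebra representation_forest_algebra]]
    by (simp add: op_category_def hFor_def fPHil0_def dual_functor_def)
next
  fix H :: "'b bhilbert"
  assume "H \<in> Obj fPHil0"
  then have H: "bounded_prelinear_hilbert_algebra H" "finite (carrier H)"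
    by (simp_all add: fPHil0_def)
  then interpret bounded_prelinear_hilbert_algebra H by blast
  have "finite irreducibles" using H(2) by (auto simp: irreducibles_def)
  then obtain e :: "'b \<Rightarrow> 'a" where "inj_on e irreducibles"
    using arb_inj_on_finite_infinite by blast
  then obtain X :: "'a based_forest" and \<sigma> where X: "representation X H \<sigma>"
    using representation_on_irreducibles[OF H] by blast
  then have "X \<in> based_forests" by (simp add: representation_def forest_def)
  then show "\<exists>X \<in> Obj (op_category (hFor :: ('a based_forest, 'a \<Rightarrow> 'a) category_data)).
      \<exists>i. iso_in fPHil0 (fobj dual_functor X) H i"
    using representations_isomorphic[OF representation_forest_algebra X]
    by (auto simp: op_category_def hFor_def dual_functor_def)
qed

theorem proposition35:
  shows "isomorphic_categories
           (ChFor :: ('a::infinite based_forest, 'a rel) category_data)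
           (hFor :: ('a based_forest, 'a \<Rightarrow> 'a) category_data)
       \<and> dually_equivalent_categories
           (hFor :: ('a based_forest, 'a \<Rightarrow> 'a) category_data)
           (fPHil0 :: ('b::infinite bhilbert, 'b \<Rightarrow> 'b) category_data)"
  using ChFor_isomorphic_hFor hFor_dually_equivalent_fPHil0 by blast

end
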